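(* Let $k\in\mathbb{N}$ and $A\in\mathbb{S}(k)$. For every $\varepsilon>0$ there exists $\delta>0$ such that the following holds for every $n\ge k$. If $\pi\in\mathbb{S}(n)$ is a permutation with $t(A,\pi)<\delta$, then there exists a permutation $\tilde\pi\in\mathbb{S}(n)$ which is $A$-avoiding and satisfies $$\sum_{i=1}^n|\pi(i)-\tilde\pi(i)|<\varepsilon n^2.$$
   Context: $[n]=\{1,\dots,n\}$ and $\mathbb{S}(n)$ is the set of all permutations (bijections $[n]\to[n]$). For $\pi\in\mathbb{S}(n)$, $k\in[n]$, $A\in\mathbb{S}(k)$ and a $k$-element subset $K\subset[n]$, we say $K$ induces the pattern $A$ in $\pi$ if for all $i,j\in[k]$: $A(i)<A(j)$ if and only if the image under $\pi$ of the $i$th smallest element of $K$ is smaller than the image under $\pi$ of the $j$th smallest element of $K$. The density $t(A,\pi)$ is the proportion of $k$-element subsets of $[n]$ (among all $\binom{n}{k}$ of them) that induce $A$ in $\pi$. $\pi$ is $A$-avoiding if $t(A,\pi)=0$. *)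

theory Defs
  imports Complex_Main "HOL-Combinatorics.Permutations"
begin

text \<open>
  Elements of \<open>\<S>(n)\<close> are functions \<open>\<pi> :: nat \<Rightarrow> nat\<close> with \<open>\<pi> permutes {1..n}\<close>.
  Indices are 1-based, whereas list indexing is 0-based.
\<close>

definition ith_smallest :: "nat set \<Rightarrow> nat \<Rightarrow> nat" where
  "ith_smallest K i = sorted_list_of_set K ! (i - 1)"

definition induces_pattern :: "nat \<Rightarrow> (nat \<Rightarrow> nat) \<Rightarrow> nat set \<Rightarrow> (nat \<Rightarrow> nat) \<Rightarrow> bool" where
  "induces_pattern k A K \<pi> \<longleftrightarrow>
     (\<forall>i\<in>{1..k}. \<forall>j\<in>{1..k}. A i < A j \<longleftrightarrow> \<pi> (ith_smallest K i) < \<pi> (ith_smallest K j))"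

text \<open>
  The pattern size \<open>k\<close> and the length \<open>n\<close> are explicit arguments, because a function of type
  \<open>nat \<Rightarrow> nat\<close> does not determine the interval on which it is regarded as a permutation.
\<close>

definition pattern_density :: "nat \<Rightarrow> (nat \<Rightarrow> nat) \<Rightarrow> nat \<Rightarrow> (nat \<Rightarrow> nat) \<Rightarrow> real" where
  "pattern_density k A n \<pi> =
     real (card {K. K \<subseteq> {1..n} \<and> card K = k \<and> induces_pattern k A K \<pi>}) / real (n choose k)"

definition pattern_avoiding :: "nat \<Rightarrow> (nat \<Rightarrow> nat) \<Rightarrow> nat \<Rightarrow> (nat \<Rightarrow> nat) \<Rightarrow> bool" where
  "pattern_avoiding k A n \<pi> \<longleftrightarrow> pattern_density k A n \<pi> = 0"

end

theory Submission
  imports Defs "HOL-Library.Ramsey" "HOL-Library.FuncSet"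
begin

text \<open>
  View \<open>\<pi>\<close> as the set of points \<open>(i, \<pi> i)\<close>, cut the values into \<open>R\<close> rows of equal height, and
  cut the positions into boundedly many intervals, the columns. A value may be moved by \<open>n / R\<close>
  at a cost that is negligible in the \<open>L1\<close>-distance, and so may be an arbitrary small
  proportion of all points. Hence only the cell (column, row) of a point matters, and the order
  inside a row may be chosen freely. The modified permutation sorts the positions by row, within a
  row by column in an order chosen for that row, and within a cell either increasingly or
  decreasingly. The choices have to be made such that each pattern which occurs afterwards was
  present in \<open>\<pi>\<close> with positive density.

  To this end each cell is given \<open>k\<close> boxes: sets \<open>B 0, \<dots>, B (k - 1)\<close> of at least \<open>\<beta> n\<close> points of
  the cell. In one column, the boxes with index \<open>a\<close> lie to the left of those with index \<open>b > a\<close>,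
  whatever their rows. In one cell, the values of the boxes increase with the index, or they
  decrease with it. The boxes of two different cells in the same row are separated in
  value. Such a system is called a framework below. If the \<open>k\<close> points of a pattern of
  the sorted permutation lie in given cells, then every choice of a point of box number \<open>a\<close> in the
  cell of the \<open>a\<close>-th point, for all \<open>a < k\<close>, is a copy of the pattern in \<open>\<pi>\<close>. This gives at least
  \<open>(\<beta> n)^k\<close> copies (\<open>framework_modification\<close>), which a small density excludes.

  It remains to find a framework that covers almost all points (\<open>framework_exists\<close>).
  Divide the rows further into fine rows. Within a column, look for \<open>K\<close> consecutive intervals of equal
  length such that for each row that the column meets there is a fine row in which all \<open>K\<close>
  intervals have many points. If they exist, Ramsey's theorem yields the boxes (\<open>boxes_exist\<close>).
  If they do not exist, then split the column into \<open>K\<close> parts, and each part again: at each splitting some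
  part loses a fine row of some row, so the average number of fine rows with many points
  drops, and after boundedly many steps almost every part has lost an entire row
  (\<open>few_alive_leaves\<close>, \<open>split_column\<close>). Deleting few points, every part then meets fewer rows than the
  original column, and induction on the number of rows met by a column finishes the
  argument. To separate the boxes of different columns, a maximal set of columns is
  chosen that use different fine rows (\<open>maximal_selection\<close>); the few points in these fine rows are
  removed from the other columns, and the following stages of the induction refine the fine rows further.
\<close>

section \<open>Rows\<close>

text \<open>
  The values \<open>1, \<dots>, n\<close> are divided into \<open>H\<close> consecutive rows, numbered from \<open>0\<close>, of nearly equal height;
  \<open>row n \<pi> H i\<close> is the row that contains the point of \<open>\<pi>\<close> at position \<open>i\<close>.
\<close>
definition row :: "nat \<Rightarrow> (nat \<Rightarrow> nat) \<Rightarrow> nat \<Rightarrow> nat \<Rightarrow> nat" where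
  "row n \<pi> H i = (\<pi> i - 1) * H div n"

text \<open>
  All of \<open>A\<close> has smaller \<open>f\<close>-value than all of \<open>B\<close>. It is used with \<open>f = id\<close> for the order of
  positions and with \<open>f = \<pi>\<close> for the order of values.
\<close>
definition before :: "(nat \<Rightarrow> nat) \<Rightarrow> nat set \<Rightarrow> nat set \<Rightarrow> bool" where
  "before f A B \<longleftrightarrow> (\<forall>i\<in>A. \<forall>j\<in>B. f i < f j)"

lemma before_mono: "before f A B \<Longrightarrow> A' \<subseteq> A \<Longrightarrow> B' \<subseteq> B \<Longrightarrow> before f A' B'"
  by (auto simp: before_def)

lemma row_mono: "\<pi> i \<le> \<pi> j \<Longrightarrow> row n \<pi> H i \<le> row n \<pi> H j"
  unfolding row_def by (intro div_le_mono mult_le_mono1 diff_le_mono)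

lemma row_less_imp: "row n \<pi> H i < row n \<pi> H j \<Longrightarrow> \<pi> i < \<pi> j"
  using row_mono[of \<pi> j i n H] by linarith

lemma row_refine: "L > 0 \<Longrightarrow> row n \<pi> (H * L) i div L = row n \<pi> H i"
  by (simp add: row_def div_mult2_eq[symmetric] mult.assoc[symmetric])

lemma row_lt:
  assumes "\<pi> permutes {1..n}" "i \<in> {1..n}" "H > 0"
  shows "row n \<pi> H i < H"
proof -
  have "\<pi> i \<in> {1..n}" using assms permutes_in_image by metis
  then have "(\<pi> i - 1) * H < n * H" using assms by (intro mult_strict_right_mono) auto
  then show ?thesis unfolding row_def using less_mult_imp_div_less by (simp add: mult.commute)
qed

lemma card_row_le:
  assumes p: "\<pi> permutes {1..n}" and H: "H > 0"
  shows "real (card {i\<in>{1..n}. row n \<pi> H i = s}) \<le> n / H + 1"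
proof (cases "{i\<in>{1..n}. row n \<pi> H i = s} = {}")
  case True then show ?thesis by (simp only: True) simp
next
  case False
  define V where "V = (\<lambda>i. \<pi> i - 1) ` {i\<in>{1..n}. row n \<pi> H i = s}"
  have inj: "inj_on (\<lambda>i. \<pi> i - 1) {i\<in>{1..n}. row n \<pi> H i = s}"
  proof (rule inj_onI)
    fix x y assume a: "x \<in> {i\<in>{1..n}. row n \<pi> H i = s}" "y \<in> {i\<in>{1..n}. row n \<pi> H i = s}"
       "\<pi> x - 1 = \<pi> y - 1"
    then have "\<pi> x \<in> {1..n}" "\<pi> y \<in> {1..n}" using p permutes_in_image by (metis (lifting) mem_Collect_eq)+
    then have "\<pi> x = \<pi> y" using a by auto
    then show "x = y" using p permutes_inj by (metis injD)
  qed
  have fin: "finite V" and ne: "V \<noteq> {}" using False by (auto simp: V_def)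
  define v where "v = Min V"
  have n: "n > 0" using False by (cases n) auto
  have div: "u * H div n = s" if "u \<in> V" for u using that by (auto simp: V_def row_def)
  have vV: "v \<in> V" using fin ne by (simp add: v_def)
  have "V \<subseteq> {v..v + n div H}"
  proof
    fix u assume u: "u \<in> V"
    have le: "v \<le> u" using u fin by (simp add: v_def)
    have "u * H < (s + 1) * n"
      using div[OF u] n by (metis dividend_less_div_times add.commute mult.commute plus_1_eq_Suc mult_Suc)
    moreover have "s * n \<le> v * H" using div[OF vV] by (metis div_times_less_eq_dividend)
    ultimately have "(u - v) * H < n" using le n by (simp only: diff_mult_distrib add_mult_distrib)
    then have "u - v \<le> n div H" using H by (simp add: less_eq_div_iff_mult_less_eq)
    then show "u \<in> {v..v + n div H}" using le by auto
  qed
  then have "card V \<le> card {v..v + n div H}" by (intro card_mono) auto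
  then have "card {i\<in>{1..n}. row n \<pi> H i = s} \<le> n div H + 1" using card_image[OF inj] by (simp add: V_def)
  then have "real (card {i\<in>{1..n}. row n \<pi> H i = s}) \<le> real (n div H) + 1" by linarith
  also have "real (n div H) \<le> n / H" by (rule of_nat_div_le_of_nat)
  finally show ?thesis by simp
qed

section \<open>Boxes from Ramsey's theorem\<close>

text \<open>
  The boxes \<open>B r a\<close> (\<open>a < k\<close>) of the cells of one column, where \<open>r\<close> ranges over the set \<open>D\<close> of rows.
  Each box has at least \<open>w\<close> points. The boxes are ordered in position by \<open>a\<close>, also across
  different rows, and in value by \<open>a\<close> within one row, in one of the two directions.
\<close>
definition boxes :: "(nat \<Rightarrow> nat) \<Rightarrow> nat \<Rightarrow> real \<Rightarrow> nat set \<Rightarrow> (nat \<Rightarrow> nat \<Rightarrow> nat set) \<Rightarrow> bool" where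
  "boxes \<pi> k w D B \<longleftrightarrow>
     (\<forall>r\<in>D. \<forall>a<k. w \<le> real (card (B r a))) \<and>
     (\<forall>r\<in>D. \<forall>r'\<in>D. \<forall>a b. a < b \<and> b < k \<longrightarrow> before id (B r a) (B r' b)) \<and>
     (\<forall>r\<in>D. (\<forall>a b. a < b \<and> b < k \<longrightarrow> before \<pi> (B r a) (B r b)) \<or>
             (\<forall>a b. a < b \<and> b < k \<longrightarrow> before \<pi> (B r b) (B r a)))"

text \<open>
  The rows are chosen greedily: those used for earlier sets contain at most \<open>K * (n / H + 1)\<close> points,
  and the points that remain are spread over at most \<open>H\<close> rows.
\<close>
lemma exists_distinct_rows:
  fixes W :: "nat \<Rightarrow> nat set"
  assumes p: "\<pi> permutes {1..n}" and H: "H > 0"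
    and sub: "\<And>a. a < K \<Longrightarrow> W a \<subseteq> {1..n}"
    and big: "\<And>a. a < K \<Longrightarrow> real H * w + real K * (n / H + 1) \<le> real (card (W a))"
  shows "\<exists>u. inj_on u {..<K} \<and> (\<forall>a<K. w \<le> real (card {i\<in>W a. row n \<pi> H i = u a}))"
  using sub big
proof (induction K)
  case 0 then show ?case by simp
next
  case (Suc K)
  have nn: "0 \<le> n / H + 1" by simp
  have "\<exists>u. inj_on u {..<K} \<and> (\<forall>a<K. w \<le> real (card {i\<in>W a. row n \<pi> H i = u a}))"
  proof (rule Suc.IH)
    fix a assume a: "a < K"
    show "W a \<subseteq> {1..n}" using Suc.prems(1) a by simp
    have "real H * w + real (Suc K) * (n / H + 1) \<le> real (card (W a))" using Suc.prems(2) a by simp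
    moreover have "real (Suc K) * (n / H + 1) = real K * (n/H+1) + (n/H+1)" by (simp only: of_nat_Suc distrib_right mult_1_left)
    ultimately show "real H * w + real K * (n / H + 1) \<le> real (card (W a))" using nn by linarith
  qed
  then obtain u where u: "inj_on u {..<K}" "\<forall>a<K. w \<le> real (card {i\<in>W a. row n \<pi> H i = u a})" by blast
  have fin: "finite (W K)" using Suc.prems(1)[of K] finite_subset by blast
  have "\<exists>x. x \<notin> u ` {..<K} \<and> w \<le> real (card {i\<in>W K. row n \<pi> H i = x})"
  proof (rule ccontr)
    assume "\<not> ?thesis"
    then have small: "real (card {i\<in>W K. row n \<pi> H i = x}) < w" if "x \<notin> u ` {..<K}" for x
      using that by force
    have "W K \<subseteq> (\<Union>x\<in>u ` {..<K}. {i\<in>{1..n}. row n \<pi> H i = x})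
              \<union> (\<Union>x\<in>{..<H} - u ` {..<K}. {i\<in>W K. row n \<pi> H i = x})"
      
    proof
      fix i assume i: "i \<in> W K"
      then have "i \<in> {1..n}" using Suc.prems(1)[of K] by blast
      then show "i \<in> (\<Union>x\<in>u ` {..<K}. {i\<in>{1..n}. row n \<pi> H i = x})
              \<union> (\<Union>x\<in>{..<H} - u ` {..<K}. {i\<in>W K. row n \<pi> H i = x})"
        using row_lt[OF p _ H, of i] i by blast
    qed
    then have "card (W K) \<le> card ((\<Union>x\<in>u ` {..<K}. {i\<in>{1..n}. row n \<pi> H i = x})
              \<union> (\<Union>x\<in>{..<H} - u ` {..<K}. {i\<in>W K. row n \<pi> H i = x}))"
      using fin by (intro card_mono) auto
    also have "\<dots> \<le> (\<Sum>x\<in>u ` {..<K}. card {i\<in>{1..n}. row n \<pi> H i = x})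
        + (\<Sum>x\<in>{..<H} - u ` {..<K}. card {i\<in>W K. row n \<pi> H i = x})"
      by (intro order.trans[OF card_Un_le] add_mono card_UN_le) auto
    finally have le: "card (W K) \<le> (\<Sum>x\<in>u ` {..<K}. card {i\<in>{1..n}. row n \<pi> H i = x})
        + (\<Sum>x\<in>{..<H} - u ` {..<K}. card {i\<in>W K. row n \<pi> H i = x})" .
    have "real (card (W K)) \<le> (\<Sum>x\<in>u ` {..<K}. real (card {i\<in>{1..n}. row n \<pi> H i = x}))
        + (\<Sum>x\<in>{..<H} - u ` {..<K}. real (card {i\<in>W K. row n \<pi> H i = x}))"
      using of_nat_mono[OF le, where ?'a = real] by (simp only: of_nat_add of_nat_sum)
    moreover have "(\<Sum>x\<in>u ` {..<K}. real (card {i\<in>{1..n}. row n \<pi> H i = x})) \<le> real K * (n / H + 1)"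
    proof -
      have "(\<Sum>x\<in>u ` {..<K}. real (card {i\<in>{1..n}. row n \<pi> H i = x})) \<le> (\<Sum>x\<in>u ` {..<K}. n / H + 1)"
        by (intro sum_mono card_row_le p H)
      also have "\<dots> = real (card (u ` {..<K})) * (n/H+1)" by simp
      also have "card (u ` {..<K}) = K" using u(1) by (simp add: card_image)
      finally show ?thesis .
    qed
    moreover have "(\<Sum>x\<in>{..<H} - u ` {..<K}. real (card {i\<in>W K. row n \<pi> H i = x})) \<le> real H * w \<or> w < 0"
    proof (cases "w < 0")
      case False
      have "(\<Sum>x\<in>{..<H} - u ` {..<K}. real (card {i\<in>W K. row n \<pi> H i = x})) \<le> (\<Sum>x\<in>{..<H} - u ` {..<K}. w)"
        by (intro sum_mono) (use small in force)
      also have "\<dots> \<le> (\<Sum>x\<in>{..<H}. w)" using False by (intro sum_mono2) auto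
      finally show ?thesis by simp
    qed simp
    moreover have "\<not> w < 0"
    proof
      assume "w < 0"
      obtain x where "x \<notin> u ` {..<K}" by (metis ex_new_if_finite finite_imageI finite_lessThan infinite_UNIV_nat)
      then show False using small \<open>w < 0\<close> by (smt (verit) of_nat_0_le_iff)
    qed
    moreover have "real H * w + real (Suc K) * (n / H + 1) \<le> real (card (W K))" using Suc.prems(2) by simp
    moreover have "real (Suc K) * (n / H + 1) = real K * (n/H+1) + (n/H+1)" by (simp only: of_nat_Suc distrib_right mult_1_left)
    moreover have "0 < n / H + 1" by (smt (verit) divide_nonneg_nonneg of_nat_0_le_iff)
    ultimately show False by linarith
  qed
  then obtain x where x: "x \<notin> u ` {..<K}" "w \<le> real (card {i\<in>W K. row n \<pi> H i = x})" by blast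
  define v where "v = u(K := x)"
  have "inj_on v {..<Suc K}" using u(1) x(1) by (auto simp: v_def inj_on_def less_Suc_eq)
  moreover have "\<forall>a<Suc K. w \<le> real (card {i\<in>W a. row n \<pi> H i = v a})"
    using u(2) x(2) by (auto simp: v_def less_Suc_eq)
  ultimately show ?case by blast
qed

text \<open>
  Simultaneous version of the theorem of Erdos and Szekeres for the \<open>R\<close> sequences \<open>u r\<close>: a pair \<open>a < b\<close>
  is coloured by the set of those \<open>r\<close> for which \<open>u r a < u r b\<close>.
\<close>
lemma ramsey_monotone:
  fixes k R :: nat
  shows "\<exists>K\<ge>(1::nat). \<forall>u :: nat \<Rightarrow> nat \<Rightarrow> nat. \<forall>D\<subseteq>{..<R}. (\<forall>r\<in>D. inj_on (u r) {..<K}) \<longrightarrow>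
     (\<exists>z. (\<forall>a<k. z a < K) \<and> (\<forall>a b. a < b \<and> b < k \<longrightarrow> z a < z b) \<and>
        (\<forall>r\<in>D. (\<forall>a b. a < b \<and> b < k \<longrightarrow> u r (z a) < u r (z b)) \<or>
               (\<forall>a b. a < b \<and> b < k \<longrightarrow> u r (z b) < u r (z a))))"
proof -
  obtain c where c: "bij_betw c (Pow {..<R}) {0..<card (Pow {..<R})}"
    using ex_bij_betw_finite_nat[of "Pow {..<R}"] by auto
  define m where "m = card (Pow {..<R})"
  obtain N :: nat where N: "partn_lst {..<N} (replicate m k) 2" using ramsey_full by blast
  have part: "partn_lst {..<Suc N} (replicate m k) 2" using N partn_lst_greater_resource by (meson le_SucI order_refl)
  show ?thesis
  proof (intro exI[of _ "Suc N"] conjI allI impI)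
    fix u :: "nat \<Rightarrow> nat \<Rightarrow> nat" and D assume D: "D \<subseteq> {..<R}" and inj: "\<forall>r\<in>D. inj_on (u r) {..<Suc N}"
    define f where "f e = c {r\<in>D. u r (Min e) < u r (Max e)}" for e
    have "f \<in> nsets {..<Suc N} 2 \<rightarrow> {..<m}"
    proof
      fix e
      have "{r\<in>D. u r (Min e) < u r (Max e)} \<in> Pow {..<R}" using D by auto
      then show "f e \<in> {..<m}" using c by (auto simp: f_def m_def bij_betw_def)
    qed
    then obtain i Z where i: "i < m" "Z \<in> nsets {..<Suc N} (replicate m k ! i)" "f ` nsets Z 2 \<subseteq> {i}"
      using partn_lstE[OF part, of f m] by (metis length_replicate)
    then have Z: "Z \<subseteq> {..<Suc N}" "finite Z" "card Z = k" by (auto simp: nsets_def)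
    define z where "z a = sorted_list_of_set Z ! a" for a
    have len: "length (sorted_list_of_set Z) = k" using Z by simp
    have zZ: "z a \<in> Z" if "a < k" for a using that len Z(2) by (metis nth_mem set_sorted_list_of_set z_def)
    have zlt: "z a < z b" if "a < b" "b < k" for a b
      using that len strict_sorted_list_of_set[of Z] by (auto simp: z_def sorted_wrt_iff_nth_less)
    have col: "c {r\<in>D. u r (z a) < u r (z b)} = i" if "a < b" "b < k" for a b
    proof -
      have lt: "z a < z b" using zlt that by blast
      have "{z a, z b} \<in> nsets Z 2" using zZ that lt by (auto simp: nsets_def)
      then have "f {z a, z b} = i" using i(3) by blast
      then show ?thesis using lt by (simp add: f_def min_def max_def)
    qed
    have same: "{r\<in>D. u r (z a) < u r (z b)} = {r\<in>D. u r (z a') < u r (z b')}"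
      if "a < b" "b < k" "a' < b'" "b' < k" for a b a' b'
    proof -
      have "{r\<in>D. u r (z a) < u r (z b)} \<in> Pow {..<R}" "{r\<in>D. u r (z a') < u r (z b')} \<in> Pow {..<R}"
        using D by auto
      moreover have "c {r\<in>D. u r (z a) < u r (z b)} = c {r\<in>D. u r (z a') < u r (z b')}"
        using col[OF that(1,2)] col[OF that(3,4)] by simp
      ultimately show ?thesis using inj_onD[OF bij_betw_imp_inj_on[OF c]] by blast
    qed
    have "(\<forall>a b. a < b \<and> b < k \<longrightarrow> u r (z a) < u r (z b)) \<or>
               (\<forall>a b. a < b \<and> b < k \<longrightarrow> u r (z b) < u r (z a))" if r: "r \<in> D" for r
    proof (cases "\<exists>a b. a < b \<and> b < k \<and> u r (z a) < u r (z b)")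
      case True
      then show ?thesis using same r by blast
    next
      case False
      have "u r (z b) < u r (z a)" if "a < b" "b < k" for a b
      proof -
        have "u r (z a) \<noteq> u r (z b)"
          using inj r zZ[of a] zZ[of b] Z(1) zlt[OF that] that inj_onD[of "u r" "{..<Suc N}" "z a" "z b"] by auto
        then show ?thesis using False that by force
      qed
      then show ?thesis by blast
    qed
    then show "\<exists>z. (\<forall>a<k. z a < Suc N) \<and> (\<forall>a b. a < b \<and> b < k \<longrightarrow> z a < z b) \<and>
        (\<forall>r\<in>D. (\<forall>a b. a < b \<and> b < k \<longrightarrow> u r (z a) < u r (z b)) \<or>
               (\<forall>a b. a < b \<and> b < k \<longrightarrow> u r (z b) < u r (z a)))"
      using zZ Z(1) zlt by (intro exI[of _ z]) blast
  qed simp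
qed

text \<open>
  Out of \<open>K\<close> sets \<open>W r a\<close> per row, ordered in position, boxes are cut as follows: each \<open>W r a\<close> is reduced
  to one of \<open>H\<close> very thin rows, different for different \<open>a\<close>, which makes the values comparable;
  \<open>k\<close> indices on which the values are monotone are then selected.
\<close>
lemma boxes_exist:
  fixes k R :: nat
  shows "\<exists>K\<ge>(1::nat). \<forall>\<beta>>(0::real). \<exists>\<beta>'>(0::real). \<exists>n0. \<forall>n\<ge>n0. \<forall>\<pi>. \<pi> permutes {1..n} \<longrightarrow> (\<forall>W. \<forall>D\<subseteq>{..<R}.
     (\<forall>r\<in>D. \<forall>a<K. W r a \<subseteq> {1..n} \<and> \<beta> * real n \<le> real (card (W r a))) \<longrightarrow>
     (\<forall>r\<in>D. \<forall>r'\<in>D. \<forall>a b. a < b \<and> b < K \<longrightarrow> before id (W r a) (W r' b)) \<longrightarrow>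
     (\<exists>B. boxes \<pi> k (\<beta>' * n) D B \<and> (\<forall>r\<in>D. \<forall>a<k. B r a \<subseteq> (\<Union>b<K. W r b))))"
proof -
  obtain K where K: "K \<ge> 1" and ram: "\<forall>u :: nat \<Rightarrow> nat \<Rightarrow> nat. \<forall>D\<subseteq>{..<R}. (\<forall>r\<in>D. inj_on (u r) {..<K}) \<longrightarrow>
     (\<exists>z. (\<forall>a<k. z a < K) \<and> (\<forall>a b. a < b \<and> b < k \<longrightarrow> z a < z b) \<and>
        (\<forall>r\<in>D. (\<forall>a b. a < b \<and> b < k \<longrightarrow> u r (z a) < u r (z b)) \<or>
               (\<forall>a b. a < b \<and> b < k \<longrightarrow> u r (z b) < u r (z a))))"
    using ramsey_monotone[of R k] by (elim exE conjE)
  show ?thesis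
  proof (intro exI[of _ K] conjI allI impI K)
    fix \<beta> :: real assume b: "\<beta> > 0"
    \<comment> \<open>With this number of rows and for large \<open>n\<close>, any \<open>K\<close> rows contain at most \<open>\<beta> n / 2\<close> points.\<close>
    obtain H :: nat where H: "4 * real K / \<beta> < H" using reals_Archimedean2 by blast
    have H0: "H > 0" using H b by (smt (verit) divide_nonneg_pos of_nat_0_le_iff gr0I of_nat_0)
    define \<beta>' where "\<beta>' = \<beta> / (2 * H)"
    obtain n0 :: nat where n0: "4 * real K / \<beta> < n0" using reals_Archimedean2 by blast
    show "\<exists>\<beta>'>(0::real). \<exists>n0. \<forall>n\<ge>n0. \<forall>\<pi>. \<pi> permutes {1..n} \<longrightarrow> (\<forall>W. \<forall>D\<subseteq>{..<R}.
     (\<forall>r\<in>D. \<forall>a<K. W r a \<subseteq> {1..n} \<and> \<beta> * real n \<le> real (card (W r a))) \<longrightarrow>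
     (\<forall>r\<in>D. \<forall>r'\<in>D. \<forall>a b. a < b \<and> b < K \<longrightarrow> before id (W r a) (W r' b)) \<longrightarrow>
     (\<exists>B. boxes \<pi> k (\<beta>' * n) D B \<and> (\<forall>r\<in>D. \<forall>a<k. B r a \<subseteq> (\<Union>b<K. W r b))))"
    proof (intro exI[of _ \<beta>'] exI[of _ n0] conjI allI impI)
      show "\<beta>' > 0" using b H0 by (simp add: \<beta>'_def)
      fix n \<pi> W D assume n: "n \<ge> n0" and p: "\<pi> permutes {1..n}" and D: "D \<subseteq> {..<R}"
        and W: "\<forall>r\<in>D. \<forall>a<K. W r a \<subseteq> {1..n} \<and> \<beta> * real n \<le> real (card (W r a))"
        and ord: "\<forall>r\<in>D. \<forall>r'\<in>D. \<forall>a b. a < b \<and> b < K \<longrightarrow> before id (W r a) (W r' b)"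
      have e1: "real H * (\<beta>' * n) = \<beta> * n / 2" using H0 by (simp add: \<beta>'_def)
      have e2: "real K * (n / H) \<le> \<beta> * n / 4"
      proof -
        have "4 * real K \<le> \<beta> * H" using H b by (simp add: field_simps)
        then have "4 * real K * n \<le> \<beta> * H * n" by (intro mult_right_mono) auto
        then show ?thesis using H0 by (simp add: field_simps)
      qed
      have e3: "real K \<le> \<beta> * n / 4"
      proof -
        have "4 * real K / \<beta> \<le> n" using n0 n by linarith
        then show ?thesis using b by (simp add: field_simps)
      qed
      have big: "real H * (\<beta>' * n) + real K * (n / H + 1) \<le> \<beta> * n"
        unfolding distrib_left mult_1_right using e1 e2 e3 by linarith
      have "\<forall>r\<in>D. \<exists>u. inj_on u {..<K} \<and> (\<forall>a<K. \<beta>' * n \<le> real (card {i\<in>W r a. row n \<pi> H i = u a}))"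
        using W big by (intro ballI exists_distinct_rows[OF p H0]) force+
      then obtain u where u: "\<forall>r\<in>D. inj_on (u r) {..<K} \<and> (\<forall>a<K. \<beta>' * n \<le> real (card {i\<in>W r a. row n \<pi> H i = u r a}))"
        by metis
      obtain z where z: "\<forall>a<k. z a < K" "\<forall>a b. a < b \<and> b < k \<longrightarrow> z a < z b"
        "\<forall>r\<in>D. (\<forall>a b. a < b \<and> b < k \<longrightarrow> u r (z a) < u r (z b)) \<or>
               (\<forall>a b. a < b \<and> b < k \<longrightarrow> u r (z b) < u r (z a))"
        using ram[THEN spec, THEN spec, THEN mp, THEN mp, OF D, of u] u by blast
      define B where "B r a = {i\<in>W r (z a). row n \<pi> H i = u r (z a)}" for r a
      have lt: "before \<pi> (B r a) (B r b)" if "u r (z a) < u r (z b)" for r a b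
        using that by (auto simp: before_def B_def intro: row_less_imp[of n \<pi> H])
      have "boxes \<pi> k (\<beta>' * n) D B"
        unfolding boxes_def
      proof (intro conjI ballI allI impI)
        fix r a assume "r \<in> D" "a < k" then show "\<beta>' * n \<le> real (card (B r a))"
          using u z(1) by (simp add: B_def)
      next
        fix r r' a b assume "r \<in> D" "r' \<in> D" "a < b \<and> b < k"
        then have "before id (W r (z a)) (W r' (z b))" using ord z by blast
        then show "before id (B r a) (B r' b)" by (rule before_mono) (auto simp: B_def)
      next
        fix r assume "r \<in> D" then show "(\<forall>a b. a < b \<and> b < k \<longrightarrow> before \<pi> (B r a) (B r b)) \<or>
             (\<forall>a b. a < b \<and> b < k \<longrightarrow> before \<pi> (B r b) (B r a))"
          using z(3) lt by blast
      qed
      moreover have "\<forall>r\<in>D. \<forall>a<k. B r a \<subseteq> (\<Union>b<K. W r b)" using z(1) by (auto simp: B_def)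
      ultimately show "\<exists>B. boxes \<pi> k (\<beta>' * n) D B \<and> (\<forall>r\<in>D. \<forall>a<k. B r a \<subseteq> (\<Union>b<K. W r b))" by blast
    qed
  qed
qed

section \<open>Splitting a column without a rich family of intervals\<close>

lemma card_less_prod:
  fixes P :: "nat \<Rightarrow> bool"
  shows "card {j. j < K * m \<and> P j} = (\<Sum>a<K. card {j. j < m \<and> P (a * m + j)})"
proof -
  have eq: "card {j. j < N \<and> Q j} = (\<Sum>j<N. if Q j then 1 else 0)" for N and Q :: "nat \<Rightarrow> bool"
    by (simp add: sum.If_cases Int_def)
  have "card {j. j < K * m \<and> P j} = (\<Sum>a<K. \<Sum>j\<in>{a * m..<a * m + m}. if P j then 1 else 0)"
    unfolding eq by (rule sum.nat_group[symmetric])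
  also have "\<dots> = (\<Sum>a<K. \<Sum>j<m. if P (a * m + j) then 1 else 0)"
  proof (rule sum.cong[OF refl])
    fix a
    have "(\<Sum>j\<in>{a * m..<a * m + m}. if P j then 1 else (0::nat)) = (\<Sum>j\<in>{0..<m}. if P (j + a * m) then 1 else 0)"
      using sum.shift_bounds_nat_ivl[of "\<lambda>j. if P j then 1 else (0::nat)" 0 "a * m" m] by (simp add: add.commute)
    then show "(\<Sum>j\<in>{a * m..<a * m + m}. if P j then 1 else (0::nat)) = (\<Sum>j<m. if P (a * m + j) then 1 else 0)"
      by (simp add: atLeast0LessThan add.commute)
  qed
  also have "\<dots> = (\<Sum>a<K. card {j. j < m \<and> P (a * m + j)})" unfolding eq ..
  finally show ?thesis .
qed

text \<open>
  Call a node of the \<open>K\<close>-ary tree of subintervals alive if for every \<open>r \<in> D\<close> it is dense in some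
  \<open>s \<in> Q r\<close>, and let \<open>\<Phi>\<close> be the number of \<open>s \<in> T\<close> in which it is dense. By the assumption \<open>nogood\<close>
  there is an \<open>r \<in> D\<close> such that for each \<open>s \<in> Q r\<close> some child is not dense in \<open>s\<close>. At an alive node
  the sum of \<open>\<Phi>\<close> over the \<open>K\<close> children is therefore less than \<open>K * \<Phi>\<close>. Hence only a proportion
  \<open>O(1 / e)\<close> of the leaves at depth \<open>e\<close> can be alive.
\<close>
lemma few_alive_leaves:
  fixes dense :: "nat set \<Rightarrow> nat \<Rightarrow> bool"
  assumes mono: "\<And>I J s. I \<subseteq> J \<Longrightarrow> dense I s \<Longrightarrow> dense J s"
    and T: "finite T" "\<And>r. r \<in> D \<Longrightarrow> Q r \<subseteq> T"
    and K: "K \<ge> 1"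
    and nogood: "\<And>p m. {p..<p + K * m} \<subseteq> c \<Longrightarrow>
        \<not> (\<forall>r\<in>D. \<exists>s\<in>Q r. \<forall>a<K. dense {p + a * m..<p + (a + 1) * m} s)"
    and sub: "{p..<p + q * K ^ e} \<subseteq> c"
  shows "e * card {j. j < K ^ e \<and> (\<forall>r\<in>D. \<exists>s\<in>Q r. dense {p + j * q..<p + (j + 1) * q} s)}
       \<le> K ^ (e + 1) * card {s\<in>T. dense {p..<p + q * K ^ e} s}"
  using sub
proof (induction e arbitrary: p)
  case 0 then show ?case by simp
next
  case (Suc e)
  define m where "m = q * K ^ e"
  define alive where "alive I = (\<forall>r\<in>D. \<exists>s\<in>Q r. dense I s)" for I
  define I where "I = {p..<p + q * K ^ Suc e}"
  define J where "J a = {p + a * m..<p + (a + 1) * m}" for a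
  define A where "A p e = card {j. j < K ^ e \<and> alive {p + j * q..<p + (j + 1) * q}}" for p e
  define \<Phi> where "\<Phi> I = card {s\<in>T. dense I s}" for I
  have I: "I = {p..<p + K * m}" by (simp add: I_def m_def algebra_simps)
  have JI: "J a \<subseteq> I" if "a < K" for a
  proof -
    have "(a + 1) * m \<le> K * m" using that by (intro mult_le_mono1) simp
    then show ?thesis unfolding J_def I by auto
  qed
  have \<Phi>mono: "\<Phi> (J a) \<le> \<Phi> I" if "a < K" for a
    unfolding \<Phi>_def using T(1) mono[OF JI[OF that]] by (intro card_mono) auto
  have leafsub: "{p + j * q..<p + (j + 1) * q} \<subseteq> I" if "j < K ^ Suc e" for j
  proof -
    have "(j + 1) * q \<le> K ^ Suc e * q" using that by (intro mult_le_mono1) simp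
    then show ?thesis unfolding I_def by (auto simp: mult.commute)
  qed
  have IH: "e * A (p + a * m) e \<le> K ^ (e + 1) * \<Phi> (J a)" if a: "a < K" for a
  proof -
    have eq: "{p + a * m..<p + a * m + q * K ^ e} = J a" by (simp add: J_def m_def algebra_simps)
    have "J a \<subseteq> c" using JI[OF a] Suc.prems by (simp add: I_def)
    then show ?thesis using Suc.IH[of "p + a * m"] unfolding A_def \<Phi>_def alive_def eq by simp
  qed
  have AS: "A p (Suc e) = (\<Sum>a<K. A (p + a * m) e)"
  proof -
    have "A p (Suc e) = card {j. j < K * K ^ e \<and> alive {p + j * q..<p + (j + 1) * q}}" by (simp add: A_def)
    also have "\<dots> = (\<Sum>a<K. card {j. j < K ^ e \<and> alive {p + (a * K ^ e + j) * q..<p + (a * K ^ e + j + 1) * q}})"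
      by (rule card_less_prod)
    also have "\<dots> = (\<Sum>a<K. A (p + a * m) e)"
      unfolding A_def m_def by (intro sum.cong refl arg_cong[where f=card] Collect_cong) (simp add: algebra_simps)
    finally show ?thesis .
  qed
  have Ale: "A p (Suc e) \<le> K ^ Suc e"
  proof -
    have "A p (Suc e) \<le> card {..<K ^ Suc e}" unfolding A_def by (intro card_mono) auto
    then show ?thesis by simp
  qed
  have goal: "Suc e * A p (Suc e) \<le> K ^ (Suc e + 1) * \<Phi> I"
  proof (cases "alive I")
    case False
    have "\<not> alive {p + j * q..<p + (j + 1) * q}" if "j < K ^ Suc e" for j
      using False leafsub[OF that] mono unfolding alive_def by blast
    then have "{j. j < K ^ Suc e \<and> alive {p + j * q..<p + (j + 1) * q}} = {}" by blast
    then have "A p (Suc e) = 0" unfolding A_def by (simp only: card.empty)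
    then show ?thesis by simp
  next
    case True
    have "{p..<p + K * m} \<subseteq> c" using Suc.prems I by (simp add: I_def)
    from nogood[OF this] obtain r where r: "r \<in> D" "\<forall>s\<in>Q r. \<exists>a<K. \<not> dense (J a) s"
      unfolding J_def by blast
    from True r(1) obtain s where s: "s \<in> Q r" "dense I s" unfolding alive_def by blast
    from r(2) s(1) obtain a0 where a0: "a0 < K" "\<not> dense (J a0) s" by blast
    have sT: "s \<in> T" using T(2) r(1) s(1) by blast
    have lt: "\<Phi> (J a0) < \<Phi> I"
      unfolding \<Phi>_def
    proof (rule psubset_card_mono)
      show "finite {s \<in> T. dense I s}" using T(1) by simp
      show "{s \<in> T. dense (J a0) s} \<subset> {s \<in> T. dense I s}"
        using mono[OF JI[OF a0(1)]] sT s(2) a0(2) by blast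
    qed
    have "(\<Sum>a<K. \<Phi> (J a)) < (\<Sum>a<K. \<Phi> I)"
      by (rule sum_strict_mono_ex1) (use \<Phi>mono lt a0 in auto)
    then have S: "(\<Sum>a<K. \<Phi> (J a)) + 1 \<le> K * \<Phi> I" by simp
    have "e * A p (Suc e) = (\<Sum>a<K. e * A (p + a * m) e)" by (simp add: AS sum_distrib_left)
    also have "\<dots> \<le> (\<Sum>a<K. K ^ (e + 1) * \<Phi> (J a))" by (intro sum_mono IH) simp
    also have "\<dots> = K ^ (e + 1) * (\<Sum>a<K. \<Phi> (J a))" by (rule sum_distrib_left[symmetric])
    finally have "Suc e * A p (Suc e) \<le> K ^ (e + 1) * ((\<Sum>a<K. \<Phi> (J a)) + 1)"
      using Ale by (simp add: algebra_simps)
    also have "\<dots> \<le> K ^ (e + 1) * (K * \<Phi> I)" using S by (rule mult_le_mono2)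
    finally show ?thesis by (simp add: algebra_simps)
  qed
  then show ?case unfolding A_def \<Phi>_def alive_def I_def .
qed

lemma before_intervals:
  "i < (j::nat) \<Longrightarrow> before id {p + i * q..<p + (i + 1) * q} {p + j * q..<p + (j + 1) * q}"
proof -
  assume "i < j"
  then have "(i + 1) * q \<le> j * q" by (intro mult_le_mono1) simp
  then show ?thesis by (auto simp: before_def)
qed

text \<open>
  If no \<open>K\<close> consecutive intervals of equal length in the column \<open>c\<close> are dense in common fine rows, one for
  each row that \<open>Y\<close> meets in \<open>c\<close>, then \<open>c\<close> can be split into parts each meeting fewer rows, at the
  expense of few points. These are the points left over because \<open>K ^ d\<close> does not divide the length
  of \<open>c\<close>, those in alive leaves, and those in fine rows in which their leaf is not dense.
\<close>
lemma split_column: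
  fixes \<theta> \<beta> :: real
  assumes p: "\<pi> permutes {1..n}" and c: "c = {p..<p + m}" "c \<subseteq> {1..n}"
    and K: "K \<ge> 1" and h: "h \<ge> 1" and R: "R \<ge> 1" and b: "\<beta> \<ge> 0"
    and D: "D = row n \<pi> R ` (Y \<inter> c)"
    and nogood: "\<not> (\<exists>p m. {p..<p + K * m} \<subseteq> c \<and> (\<forall>r\<in>D. \<exists>s<R * h. s div h = r \<and>
       (\<forall>a<K. \<beta> * n \<le> real (card {i\<in>Y \<inter> {p + a * m..<p + (a + 1) * m}. row n \<pi> (R * h) i = s}))))"
    and d: "d \<ge> 1" "real (K * (R * h)) \<le> \<theta> * d"
  shows "\<exists>P Y'. finite P \<and> card P \<le> K ^ d \<and> (\<forall>L\<in>P. L \<subseteq> c \<and> (\<exists>p m. L = {p..<p + m})) \<and>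
     (\<forall>L\<in>P. \<forall>L'\<in>P. L \<noteq> L' \<longrightarrow> before id L L' \<or> before id L' L) \<and>
     Y' \<subseteq> Y \<inter> c \<and> Y' \<subseteq> \<Union>P \<and> (\<forall>L\<in>P. card (row n \<pi> R ` (Y' \<inter> L)) < card D) \<and>
     real (card (Y \<inter> c - Y')) \<le> real (K ^ d) + \<theta> * card c + real (K ^ d * (R * h)) * (\<beta> * n)"
proof -
  define q where "q = m div K ^ d"
  define L where "L j = {p + j * q..<p + (j + 1) * q}" for j
  define dense where "dense I s \<longleftrightarrow> \<beta> * n \<le> real (card {i\<in>Y \<inter> I. row n \<pi> (R * h) i = s})" for I s
  define Q where "Q r = {s. s < R * h \<and> s div h = r}" for r
  define alive where "alive I \<longleftrightarrow> (\<forall>r\<in>D. \<exists>s\<in>Q r. dense I s)" for I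
  define Y' where "Y' = {i\<in>Y \<inter> c. \<exists>j<K ^ d. i \<in> L j \<and> \<not> alive (L j) \<and> dense (L j) (row n \<pi> (R * h) i)}"
  have finc: "finite c" and finYc: "finite (Y \<inter> c)" using c by auto
  have finD: "finite D" using D finYc by simp
  have Kd: "K ^ d > 0" using K by simp
  have qm: "q * K ^ d \<le> m" unfolding q_def by (rule div_times_less_eq_dividend)
  have Lc: "L j \<subseteq> c" if "j < K ^ d" for j
  proof -
    have "(j + 1) * q \<le> K ^ d * q" using that by (intro mult_le_mono1) simp
    then have "(j + 1) * q \<le> m" using qm by (simp add: mult.commute)
    then show ?thesis unfolding L_def c by auto
  qed
  have bL: "before id (L i) (L j)" if "i < j" for i j
    unfolding L_def using that by (rule before_intervals)
  have same: "j = j'" if "i \<in> L j" "i \<in> L j'" for i j j'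
    using bL[of j j'] bL[of j' j] that by (auto simp: before_def) (meson linorder_neqE_nat less_irrefl)
  have rowR: "row n \<pi> (R * h) i div h = row n \<pi> R i" for i using h by (intro row_refine) simp
  have rowQ: "row n \<pi> (R * h) i \<in> Q (row n \<pi> R i)" if "i \<in> c" for i
    using row_lt[OF p, of i "R * h"] that c(2) R h rowR[of i] unfolding Q_def by auto
  have dmono: "dense J s" if "I \<subseteq> J" "I \<subseteq> c" "J \<subseteq> c" "dense I s" for I J s
  proof -
    have "finite (Y \<inter> J)" using that(3) finc by (meson finite_Int finite_subset)
    then have "card {i\<in>Y \<inter> I. row n \<pi> (R * h) i = s} \<le> card {i\<in>Y \<inter> J. row n \<pi> (R * h) i = s}"
      using that(1) by (intro card_mono) (auto elim!: rev_finite_subset)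
    then show ?thesis using that(4) unfolding dense_def by linarith
  qed
  have nogood': "\<not> (\<forall>r\<in>D. \<exists>s\<in>Q r. \<forall>a<K. dense {p + a * m..<p + (a + 1) * m} s)"
    if "{p..<p + K * m} \<subseteq> c" for p m
    using nogood that unfolding dense_def Q_def by blast
  have Dne: "D \<noteq> {}" using nogood'[of 0 0] by auto
  define A where "A = card {j. j < K ^ d \<and> alive (L j)}"
  have "d * A \<le> K ^ (d + 1) * card {s\<in>{..<R * h}. dense ({p..<p + q * K ^ d} \<inter> c) s}"
  proof -
    have sub: "{p..<p + q * K ^ d} \<subseteq> c" unfolding c using qm by auto
    have "d * card {j. j < K ^ d \<and> (\<forall>r\<in>D. \<exists>s\<in>Q r. dense ({p + j * q..<p + (j + 1) * q} \<inter> c) s)}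
       \<le> K ^ (d + 1) * card {s\<in>{..<R * h}. dense ({p..<p + q * K ^ d} \<inter> c) s}"
      \<comment> \<open>Density is monotone only for subsets of \<open>c\<close>, where all sets are finite; hence the intersection.\<close>
    proof (rule few_alive_leaves[where dense = "\<lambda>I. dense (I \<inter> c)", OF _ _ _ K _ sub])
      show "dense (J \<inter> c) s" if "I \<subseteq> J" "dense (I \<inter> c) s" for I J s
        using dmono[of "I \<inter> c" "J \<inter> c" s] that by blast
      show "finite {..<R * h}" by simp
      show "Q r \<subseteq> {..<R * h}" for r by (auto simp: Q_def)
      fix p' m' assume sub': "{p'..<p' + K * m'} \<subseteq> c"
      have eq: "{p' + a * m'..<p' + (a + 1) * m'} \<inter> c = {p' + a * m'..<p' + (a + 1) * m'}" if "a < K" for a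
      proof -
        have "(a + 1) * m' \<le> K * m'" using that by (intro mult_le_mono1) simp
        then have "{p' + a * m'..<p' + (a + 1) * m'} \<subseteq> {p'..<p' + K * m'}" by auto
        then show ?thesis using sub' by blast
      qed
      show "\<not> (\<forall>r\<in>D. \<exists>s\<in>Q r. \<forall>a<K. dense ({p' + a * m'..<p' + (a + 1) * m'} \<inter> c) s)"
        using nogood'[OF sub'] eq by auto
    qed
    moreover have "{j. j < K ^ d \<and> (\<forall>r\<in>D. \<exists>s\<in>Q r. dense ({p + j * q..<p + (j + 1) * q} \<inter> c) s)} = {j. j < K ^ d \<and> alive (L j)}"
    proof -
      have "L j \<inter> c = L j" if "j < K ^ d" for j using Lc[OF that] by blast
      then show ?thesis unfolding alive_def L_def[symmetric] by auto
    qed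
    ultimately show ?thesis unfolding A_def by simp
  qed
  also have "\<dots> \<le> K ^ (d + 1) * card {..<R * h}" by (intro mult_le_mono2 card_mono) auto
  finally have "d * A \<le> K ^ d * (K * (R * h))" by (simp add: algebra_simps)
  then have "real d * real A \<le> real (K ^ d) * real (K * (R * h))" by (metis of_nat_mono of_nat_mult)
  also have "\<dots> \<le> real (K ^ d) * (\<theta> * d)" using d(2) by (intro mult_left_mono) auto
  finally have "real d * real A \<le> real d * (\<theta> * real (K ^ d))" by (simp only: mult.commute mult.left_commute)
  then have Ale: "real A \<le> \<theta> * real (K ^ d)" using d(1) by (simp add: mult_le_cancel_left)
  have \<theta>: "\<theta> \<ge> 0" 
  proof -
    have "0 \<le> \<theta> * real d" using d(2) by (rule order.trans[rotated]) simp
    then show ?thesis using d(1) by (auto simp: zero_le_mult_iff)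
  qed
  have Aq: "real (A * q) \<le> \<theta> * card c"
  proof -
    have "real (A * q) \<le> \<theta> * real (K ^ d) * real q" using Ale by (simp add: mult_right_mono)
    also have "\<dots> = \<theta> * real (q * K ^ d)" by simp
    also have "\<dots> \<le> \<theta> * real m" using qm \<theta> by (intro mult_left_mono) (simp_all only: of_nat_le_iff)
    finally show ?thesis using c(1) by simp
  qed
  define Z where "Z j s = (if dense (L j) s then {} else {i\<in>Y \<inter> L j. row n \<pi> (R * h) i = s})" for j s
  have cov: "Y \<inter> c - Y' \<subseteq> {p + q * K ^ d..<p + m} \<union> (\<Union>j\<in>{j. j < K ^ d \<and> alive (L j)}. L j)
        \<union> (\<Union>j<K ^ d. \<Union>s<R * h. Z j s)"
  proof
    fix i assume i: "i \<in> Y \<inter> c - Y'"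
    then have ic: "i \<in> c" "i \<in> Y" by auto
    show "i \<in> {p + q * K ^ d..<p + m} \<union> (\<Union>j\<in>{j. j < K ^ d \<and> alive (L j)}. L j)
        \<union> (\<Union>j<K ^ d. \<Union>s<R * h. Z j s)"
    proof (cases "i < p + q * K ^ d")
      case False then show ?thesis using ic c by auto
    next
      case True
      define j where "j = (i - p) div q"
      have pi: "p \<le> i" using ic c by auto
      have q0: "q > 0" using True pi by (cases q) auto
      have "i - p < K ^ d * q" using True pi by (simp add: mult.commute less_diff_conv2)
      then have j: "j < K ^ d" unfolding j_def using less_mult_imp_div_less by blast
      have "j * q \<le> i - p" unfolding j_def by (rule div_times_less_eq_dividend)
      moreover have "i - p < (j + 1) * q" unfolding j_def using dividend_less_div_times[OF q0, of "i - p"] by simp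
      ultimately have iL: "i \<in> L j" unfolding L_def using pi by auto
      show ?thesis
      proof (cases "alive (L j)")
        case True then show ?thesis using iL j by blast
      next
        case False
        then have "\<not> dense (L j) (row n \<pi> (R * h) i)" using i iL j unfolding Y'_def by blast
        then have "i \<in> Z j (row n \<pi> (R * h) i)" unfolding Z_def using iL ic by simp
        moreover have "row n \<pi> (R * h) i < R * h" using rowQ[OF ic(1)] by (simp add: Q_def)
        ultimately show ?thesis using j by blast
      qed
    qed
  qed
  have Zle: "real (card (Z j s)) \<le> \<beta> * n" for j s
    using b unfolding Z_def dense_def by auto
  have finL: "finite (L j)" for j by (simp add: L_def)
  have finZ: "finite (Z j s)" for j s using finL[of j] by (auto simp: Z_def)
  have "card (Y \<inter> c - Y') \<le> card ({p + q * K ^ d..<p + m} \<union> (\<Union>j\<in>{j. j < K ^ d \<and> alive (L j)}. L j)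
        \<union> (\<Union>j<K ^ d. \<Union>s<R * h. Z j s))"
    using finL finZ by (intro card_mono[OF _ cov]) auto
  also have "\<dots> \<le> card {p + q * K ^ d..<p + m} + card (\<Union>j\<in>{j. j < K ^ d \<and> alive (L j)}. L j)
        + card (\<Union>j<K ^ d. \<Union>s<R * h. Z j s)"
    by (intro order.trans[OF card_Un_le] add_mono card_Un_le order_refl)
  also have "\<dots> \<le> K ^ d + A * q + (\<Sum>j<K ^ d. \<Sum>s<R * h. card (Z j s))"
  proof (intro add_mono)
    have "m mod K ^ d \<le> K ^ d" using Kd by (simp add: less_imp_le)
    then show "card {p + q * K ^ d..<p + m} \<le> K ^ d" unfolding q_def by (simp add: minus_div_mult_eq_mod)
    have "card (\<Union>j\<in>{j. j < K ^ d \<and> alive (L j)}. L j) \<le> (\<Sum>j\<in>{j. j < K ^ d \<and> alive (L j)}. card (L j))"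
      by (rule card_UN_le) simp
    then show "card (\<Union>j\<in>{j. j < K ^ d \<and> alive (L j)}. L j) \<le> A * q" by (simp add: L_def A_def)
    show "card (\<Union>j<K ^ d. \<Union>s<R * h. Z j s) \<le> (\<Sum>j<K ^ d. \<Sum>s<R * h. card (Z j s))"
      by (intro order.trans[OF card_UN_le] sum_mono card_UN_le) auto
  qed
  finally have "real (card (Y \<inter> c - Y')) \<le> real (K ^ d + A * q + (\<Sum>j<K ^ d. \<Sum>s<R * h. card (Z j s)))"
    by (rule of_nat_mono)
  also have "\<dots> = real (K ^ d) + real (A * q) + (\<Sum>j<K ^ d. \<Sum>s<R * h. real (card (Z j s)))"
    by (simp only: of_nat_add of_nat_sum)
  also have "(\<Sum>j<K ^ d. \<Sum>s<R * h. real (card (Z j s))) \<le> (\<Sum>j<K ^ d. \<Sum>s<R * h. \<beta> * n)"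
    by (intro sum_mono Zle)
  also have "(\<Sum>j<K ^ d. \<Sum>s<R * h. \<beta> * n) = real (K ^ d * (R * h)) * (\<beta> * n)" by simp
  finally have bound: "real (card (Y \<inter> c - Y')) \<le> real (K ^ d) + \<theta> * card c + real (K ^ d * (R * h)) * (\<beta> * n)"
    using Aq by linarith
  have fewer: "card (row n \<pi> R ` (Y' \<inter> L j)) < card D" if "j < K ^ d" for j
  proof (cases "alive (L j)")
    case True
    then have "Y' \<inter> L j = {}" using same unfolding Y'_def by blast
    then show ?thesis using Dne finD by (simp add: card_gt_0_iff)
  next
    case False
    then obtain r where r: "r \<in> D" "\<forall>s\<in>Q r. \<not> dense (L j) s" unfolding alive_def by blast
    have "row n \<pi> R i \<in> D - {r}" if "i \<in> Y' \<inter> L j" for i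
    proof -
      have i: "i \<in> Y \<inter> c" "dense (L j) (row n \<pi> (R * h) i)" using that same unfolding Y'_def by blast+
      then show ?thesis using r rowQ[of i] D by blast
    qed
    then have "row n \<pi> R ` (Y' \<inter> L j) \<subset> D" using r(1) by blast
    then show ?thesis using finD psubset_card_mono by blast
  qed
  show ?thesis
  proof (intro exI[of _ "L ` {..<K ^ d}"] exI[of _ Y'] conjI bound ballI impI)
    show "finite (L ` {..<K ^ d})" by simp
    show "card (L ` {..<K ^ d}) \<le> K ^ d" using card_image_le[of "{..<K^d}" L] by simp
    show "Y' \<subseteq> Y \<inter> c" by (auto simp: Y'_def)
    show "Y' \<subseteq> \<Union> (L ` {..<K ^ d})" by (auto simp: Y'_def)
  next
    fix I assume "I \<in> L ` {..<K ^ d}"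
    then obtain j where j: "j < K ^ d" "I = L j" by blast
    show "I \<subseteq> c" "card (row n \<pi> R ` (Y' \<inter> I)) < card D" using j Lc fewer by auto
    show "\<exists>p m. I = {p..<p + m}" using j(2) unfolding L_def
      by (intro exI[of _ "p + j * q"] exI[of _ q]) (simp add: algebra_simps)
  next
    fix I I' assume "I \<in> L ` {..<K ^ d}" "I' \<in> L ` {..<K ^ d}" "I \<noteq> I'"
    then obtain j j' where "I = L j" "I' = L j'" "j \<noteq> j'" by blast
    then show "before id I I' \<or> before id I' I" using bL by (meson linorder_neqE_nat)
  qed
qed

section \<open>Columns and the selection of fine rows\<close>

text \<open>A family of sets of positions, the columns, any two of which are comparable from left to right.\<close>
definition ordered_family :: "nat set set \<Rightarrow> bool" where
  "ordered_family C \<longleftrightarrow> (\<forall>c\<in>C. \<forall>c'\<in>C. c \<noteq> c' \<longrightarrow> before id c c' \<or> before id c' c)"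

lemma ordered_familyD:
  "ordered_family C \<Longrightarrow> c \<in> C \<Longrightarrow> c' \<in> C \<Longrightarrow> c \<noteq> c' \<Longrightarrow> before id c c' \<or> before id c' c"
  by (simp add: ordered_family_def)

lemma ordered_family_disjoint:
  "ordered_family C \<Longrightarrow> c \<in> C \<Longrightarrow> c' \<in> C \<Longrightarrow> i \<in> c \<Longrightarrow> i \<in> c' \<Longrightarrow> c = c'"
  unfolding ordered_family_def before_def by (metis id_apply less_irrefl)

lemma ordered_family_card:
  assumes "ordered_family C" "finite C" "\<And>c. c \<in> C \<Longrightarrow> c \<subseteq> {1..n}"
  shows "(\<Sum>c\<in>C. card c) \<le> n"
proof -
  have "(\<Sum>c\<in>C. card c) = card (\<Union>c\<in>C. c)"
  proof (rule card_UN_disjoint[symmetric])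
    show "\<forall>c\<in>C. \<forall>c'\<in>C. c \<noteq> c' \<longrightarrow> c \<inter> c' = {}"
      using ordered_family_disjoint[OF assms(1)] by blast
  qed (use assms(2,3) in \<open>auto intro: finite_subset\<close>)
  also have "\<dots> \<le> card {1..n}" using assms(3) by (intro card_mono) auto
  finally show ?thesis by simp
qed

text \<open>
  The column \<open>c\<close> contains \<open>K\<close> sets \<open>I a\<close>, ordered from left to right, such that for each row \<open>r \<in> D\<close> the fine row \<open>s r\<close>,
  one of the fine rows \<open>Q r\<close> that make up \<open>r\<close>, contains at least \<open>w\<close> points of \<open>Z\<close> in every \<open>I a\<close>. The fine row
  of the point at position \<open>i\<close> is \<open>f i\<close>.
\<close>
definition rich :: "nat \<Rightarrow> real \<Rightarrow> (nat \<Rightarrow> nat) \<Rightarrow> (nat \<Rightarrow> nat set) \<Rightarrow> nat set \<Rightarrow> nat set \<Rightarrow> nat set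
     \<Rightarrow> (nat \<Rightarrow> nat) \<Rightarrow> (nat \<Rightarrow> nat set) \<Rightarrow> bool" where
  "rich K w f Q Z c D s I \<longleftrightarrow>
     (\<forall>a<K. I a \<subseteq> c) \<and> (\<forall>a b. a < b \<and> b < K \<longrightarrow> before id (I a) (I b)) \<and>
     (\<forall>r\<in>D. s r \<in> Q r \<and> (\<forall>a<K. w \<le> real (card {i\<in>Z \<inter> I a. f i = s r})))"

lemma rich_mono:
  assumes "rich K w f Q Z c D s I" "Z \<subseteq> Z'" "finite Z'"
  shows "rich K w f Q Z' c D s I"
proof -
  have "card {i\<in>Z \<inter> I a. f i = s r} \<le> card {i\<in>Z' \<inter> I a. f i = s r}" for a r
    using assms(2,3) by (intro card_mono) auto
  then have "real (card {i\<in>Z \<inter> I a. f i = s r}) \<le> real (card {i\<in>Z' \<inter> I a. f i = s r})" for a r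
    using of_nat_mono by blast
  then show ?thesis using assms(1) unfolding rich_def by (meson order.trans)
qed

text \<open>
  A maximal set \<open>S\<close> of columns that are rich with pairwise different fine rows in the same row. Every
  other column is not rich after removal of the points in the fine rows that \<open>S\<close> uses. A column
  in \<open>S\<close> need not treat all rows that it meets; those missing have all their points in fine rows
  used by \<open>S\<close>, and these points are given up.
\<close>
lemma maximal_selection:
  assumes C: "finite C" and X: "finite X" and w: "w > 0" and K: "K \<ge> 1"
  shows "\<exists>S s D I. S \<subseteq> C \<and>
     (\<forall>c\<in>S. D c \<subseteq> \<rho> ` (X \<inter> c) \<and> rich K w f Q X c (D c) (s c) (I c)) \<and>
     (\<forall>c\<in>S. \<forall>c'\<in>S. c \<noteq> c' \<longrightarrow> (\<forall>r\<in>D c \<inter> D c'. s c r \<noteq> s c' r)) \<and>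
     (\<forall>c\<in>S. \<forall>i\<in>X \<inter> c. \<rho> i \<in> D c \<or> f i \<in> (\<Union>c\<in>S. s c ` D c)) \<and>
     (\<forall>c\<in>C - S. \<forall>s' I'. \<not> rich K w f Q {i\<in>X. f i \<notin> (\<Union>c\<in>S. s c ` D c)} c
         (\<rho> ` ({i\<in>X. f i \<notin> (\<Union>c\<in>S. s c ` D c)} \<inter> c)) s' I')"
proof -
  define sel where "sel S s D I \<longleftrightarrow> S \<subseteq> C \<and>
     (\<forall>c\<in>S. D c \<subseteq> \<rho> ` (X \<inter> c) \<and> rich K w f Q X c (D c) (s c) (I c)) \<and>
     (\<forall>c\<in>S. \<forall>c'\<in>S. c \<noteq> c' \<longrightarrow> (\<forall>r\<in>D c \<inter> D c'. s c r \<noteq> s c' r)) \<and>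
     (\<forall>c\<in>S. \<forall>i\<in>X \<inter> c. \<rho> i \<in> D c \<or> f i \<in> (\<Union>c\<in>S. s c ` D c))" for S s D I
  have "sel {} s D I" for s D I by (simp add: sel_def)
  moreover have "\<forall>S. (\<exists>s D I. sel S s D I) \<longrightarrow> card S < card C + 1"
    using C by (auto simp: sel_def less_Suc_eq_le intro: card_mono)
  ultimately obtain S where S: "\<exists>s D I. sel S s D I" "\<forall>T. (\<exists>s D I. sel T s D I) \<longrightarrow> card T \<le> card S"
    using ex_has_greatest_nat[of "\<lambda>S. \<exists>s D I. sel S s D I" "{}" card] by blast
  then obtain s D I where sel: "sel S s D I" by blast
  define F where "F = (\<Union>c\<in>S. s c ` D c)"
  define Y where "Y = {i\<in>X. f i \<notin> F}"
  have YX: "Y \<subseteq> X" by (auto simp: Y_def)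
  have "\<not> rich K w f Q Y c (\<rho> ` (Y \<inter> c)) s' I'" if c: "c \<in> C - S" for c s' I'
  proof
    assume rich: "rich K w f Q Y c (\<rho> ` (Y \<inter> c)) s' I'"
    define D' where "D' = \<rho> ` (Y \<inter> c)"
    have new: "s' r \<notin> F" if "r \<in> D'" for r
    proof -
      have "w \<le> real (card {i\<in>Y \<inter> I' 0. f i = s' r})" using rich that K unfolding rich_def D'_def by fastforce
      then have "0 < real (card {i\<in>Y \<inter> I' 0. f i = s' r})" using w by linarith
      then have "card {i\<in>Y \<inter> I' 0. f i = s' r} \<noteq> 0" by simp
      then have "{i\<in>Y \<inter> I' 0. f i = s' r} \<noteq> {}" by (metis card.empty)
      then obtain i where "i \<in> Y" "f i = s' r" by blast
      then show ?thesis by (auto simp: Y_def)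
    qed
    have cS: "c \<notin> S" using c by blast
    let ?s = "s(c := s')" and ?D = "D(c := D')" and ?I = "I(c := I')"
    have F': "(\<Union>c\<in>insert c S. ?s c ` ?D c) = s' ` D' \<union> F"
    proof -
      have "(\<Union>x\<in>S. ?s x ` ?D x) = F" unfolding F_def using cS by (intro SUP_cong refl) auto
      then show ?thesis by simp
    qed
    have "sel (insert c S) ?s ?D ?I"
      unfolding sel_def F'
    proof (intro conjI ballI impI)
      show "insert c S \<subseteq> C" using c sel by (simp add: sel_def)
    next
      fix x assume "x \<in> insert c S"
      then show "?D x \<subseteq> \<rho> ` (X \<inter> x)" "rich K w f Q X x (?D x) (?s x) (?I x)"
        using sel cS rich_mono[OF rich YX X] YX by (auto simp: sel_def D'_def)
    next
      fix x y r assume xy: "x \<in> insert c S" "y \<in> insert c S" "x \<noteq> y" and r: "r \<in> ?D x \<inter> ?D y"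
      have inF: "s z r \<in> F" if "z \<in> S" "r \<in> D z" for z using that by (auto simp: F_def)
      show "?s x r \<noteq> ?s y r"
      proof (cases "x = c \<or> y = c")
        case True
        then show ?thesis using xy r new[of r] inF by (auto split: if_splits) metis+
      next
        case False
        then show ?thesis using xy r sel by (simp add: sel_def)
      qed
    next
      fix x i assume "x \<in> insert c S" "i \<in> X \<inter> x"
      then show "\<rho> i \<in> ?D x \<or> f i \<in> s' ` D' \<union> F"
        using sel cS by (cases "x = c") (auto simp: sel_def D'_def Y_def F_def)
    qed
    then have "card (insert c S) \<le> card S" using S(2) by blast
    moreover have "finite S" using sel C finite_subset by (auto simp: sel_def)
    ultimately show False using cS by simp
  qed
  then have last: "\<forall>c\<in>C - S. \<forall>s' I'. \<not> rich K w f Q Y c (\<rho> ` (Y \<inter> c)) s' I'" by blast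
  show ?thesis
    using sel last unfolding sel_def Y_def F_def
    by (intro exI[of _ S] exI[of _ s] exI[of _ D] exI[of _ I]) (elim conjE, intro conjI; assumption)
qed

lemma boxes_mono:
  assumes "boxes \<pi> k w D B" "w' \<le> w" "D' \<subseteq> D"
  shows "boxes \<pi> k w' D' B"
proof -
  have "\<forall>r\<in>D'. \<forall>a<k. w' \<le> real (card (B r a))"
    using assms unfolding boxes_def by (meson order.trans subsetD)
  then show ?thesis using assms(1,3) unfolding boxes_def by blast
qed

lemma before_rows:
  assumes "\<And>i. i \<in> A \<Longrightarrow> row n \<pi> H i = u" "\<And>i. i \<in> B \<Longrightarrow> row n \<pi> H i = v" "u \<noteq> v"
  shows "before \<pi> A B \<or> before \<pi> B A"
proof (cases "u < v")
  case True
  then have "before \<pi> A B" using assms row_less_imp[of n \<pi> H] by (simp add: before_def)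
  then show ?thesis ..
next
  case False
  then have "before \<pi> B A" using assms row_less_imp[of n \<pi> H] by (simp add: before_def)
  then show ?thesis ..
qed

section \<open>Existence of a framework\<close>

text \<open>
  A framework: the set \<open>X\<close> of points that are kept is covered by an ordered family \<open>S\<close> of columns;
  each cell \<open>(c, r)\<close> with \<open>c \<in> S\<close> that contains a point of \<open>X\<close> has boxes \<open>B c r a\<close> inside the cell; and the
  boxes of different columns in the same row are separated in value. The points of the boxes
  need not belong to \<open>X\<close>.
\<close>
definition framework :: "nat \<Rightarrow> (nat \<Rightarrow> nat) \<Rightarrow> nat \<Rightarrow> nat \<Rightarrow> real \<Rightarrow> nat set set \<Rightarrow> nat set
     \<Rightarrow> (nat set \<Rightarrow> nat \<Rightarrow> nat \<Rightarrow> nat set) \<Rightarrow> bool" where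
  "framework n \<pi> k R w S X B \<longleftrightarrow>
     ordered_family S \<and> X \<subseteq> \<Union>S \<and>
     (\<forall>c\<in>S. boxes \<pi> k w (row n \<pi> R ` (X \<inter> c)) (B c)) \<and>
     (\<forall>c\<in>S. \<forall>r\<in>row n \<pi> R ` (X \<inter> c). \<forall>a<k. B c r a \<subseteq> c \<inter> {i\<in>{1..n}. row n \<pi> R i = r}) \<and>
     (\<forall>c\<in>S. \<forall>c'\<in>S. c \<noteq> c' \<longrightarrow> (\<forall>r\<in>row n \<pi> R ` (X \<inter> c) \<inter> row n \<pi> R ` (X \<inter> c').
        before \<pi> (\<Union>a<k. B c r a) (\<Union>a<k. B c' r a) \<or> before \<pi> (\<Union>a<k. B c' r a) (\<Union>a<k. B c r a)))"

text \<open>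
  The claim of the induction: for at most \<open>N\<close> columns, each meeting at most \<open>t\<close> of the \<open>R\<close> rows in points of
  \<open>X\<close>, there is a framework in subsets of these columns that covers all but \<open>\<theta> n\<close> points of \<open>X\<close>. The boxes
  consist of points of \<open>X\<close>, and those of one cell lie in a single row of the division into
  \<open>R * h0\<close> rows; this keeps them separated from boxes that were chosen earlier in rows of
  that division which \<open>X\<close> avoids.
\<close>
definition framework_claim :: "nat \<Rightarrow> nat \<Rightarrow> nat \<Rightarrow> real \<Rightarrow> nat \<Rightarrow> nat \<Rightarrow> real \<Rightarrow> nat \<Rightarrow> bool" where
  "framework_claim k R t \<theta> N h0 \<beta> n \<longleftrightarrow>
    (\<forall>\<pi> C X. \<pi> permutes {1..n} \<longrightarrow> finite C \<longrightarrow> card C \<le> N \<longrightarrow>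
       (\<forall>c\<in>C. c \<subseteq> {1..n} \<and> (\<exists>p m. c = {p..<p + m})) \<longrightarrow> ordered_family C \<longrightarrow> X \<subseteq> \<Union>C \<longrightarrow>
       (\<forall>c\<in>C. card (row n \<pi> R ` (X \<inter> c)) \<le> t) \<longrightarrow>
       (\<exists>S X' B. framework n \<pi> k R (\<beta> * n) S X' B \<and> X' \<subseteq> X \<and> real (card (X - X')) \<le> \<theta> * n \<and>
          (\<forall>c\<in>S. \<exists>c0\<in>C. c \<subseteq> c0) \<and>
          (\<forall>c\<in>S. \<forall>r\<in>row n \<pi> R ` (X' \<inter> c). (\<forall>a<k. B c r a \<subseteq> X) \<and>
             (\<exists>u. \<forall>a<k. \<forall>i\<in>B c r a. row n \<pi> (R * h0) i = u))))"

text \<open>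
  The induction step. The columns in \<open>S1\<close> receive boxes at once. All the others are split, after
  removal of the points in the fine rows used by \<open>S1\<close>, into parts meeting fewer rows, to which the
  induction hypothesis applies with the finer division into \<open>R * h\<close> rows. Points are lost to the fine
  rows used by \<open>S1\<close>, in the splitting (three kinds) and in the induction hypothesis, at
  most \<open>\<theta> n\<close> each time.
\<close>
lemma framework_step:
  fixes \<theta> \<beta> \<beta>1 \<beta>2 \<beta>3 :: real
  assumes p: "\<pi> permutes {1..n}" and R: "R \<ge> 1" and h0: "h0 \<ge> 1" and L: "L \<ge> 1" and K: "K \<ge> 1"
    and C: "finite C" "card C \<le> N" "\<And>c. c \<in> C \<Longrightarrow> c \<subseteq> {1..n} \<and> (\<exists>p m. c = {p..<p + m})" "ordered_family C"
    and X: "X \<subseteq> \<Union>C" "\<And>c. c \<in> C \<Longrightarrow> card (row n \<pi> R ` (X \<inter> c)) \<le> Suc t"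
    and h: "h = h0 * L" and n: "n \<ge> 1"
    and pos: "\<theta> > 0" "\<beta>1 > 0" "\<beta> \<le> \<beta>2" "\<beta> \<le> \<beta>3"
    and d: "d \<ge> 1" "real (K * (R * h)) \<le> \<theta> * d"
    and small: "real (N * R) * (n / real (R * h) + 1) \<le> \<theta> * n" "real (N * K ^ d) \<le> \<theta> * n"
      "real (N * (K ^ d * (R * h))) * \<beta>1 \<le> \<theta>"
    and box: "\<And>W D. D \<subseteq> {..<R} \<Longrightarrow>
     (\<forall>r\<in>D. \<forall>a<K. W r a \<subseteq> {1..n} \<and> \<beta>1 * real n \<le> real (card (W r a))) \<Longrightarrow>
     (\<forall>r\<in>D. \<forall>r'\<in>D. \<forall>a b. a < b \<and> b < K \<longrightarrow> before id (W r a) (W r' b)) \<Longrightarrow>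
     (\<exists>B. boxes \<pi> k (\<beta>2 * n) D B \<and> (\<forall>r\<in>D. \<forall>a<k. B r a \<subseteq> (\<Union>b<K. W r b)))"
    and IH: "framework_claim k R t \<theta> (N * K ^ d) h \<beta>3 n"
  shows "\<exists>S X' B. framework n \<pi> k R (\<beta> * n) S X' B \<and> X' \<subseteq> X \<and> real (card (X - X')) \<le> 5 * \<theta> * n \<and>
          (\<forall>c\<in>S. \<exists>c0\<in>C. c \<subseteq> c0) \<and>
          (\<forall>c\<in>S. \<forall>r\<in>row n \<pi> R ` (X' \<inter> c). (\<forall>a<k. B c r a \<subseteq> X) \<and>
             (\<exists>u. \<forall>a<k. \<forall>i\<in>B c r a. row n \<pi> (R * h0) i = u))"
proof -
  define f where "f = row n \<pi> (R * h)"
  define \<rho> where "\<rho> = row n \<pi> R"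
  define Q where "Q r = {s. s < R * h \<and> s div h = r}" for r
  have h1: "h \<ge> 1" using h h0 L by simp
  have Xn: "X \<subseteq> {1..n}" using X(1) C(3) by blast
  have finX: "finite X" using Xn finite_subset by blast
  have w: "\<beta>1 * n > 0" using pos n by simp
  have f_div: "f i div h = \<rho> i" for i unfolding f_def \<rho>_def using h1 by (intro row_refine) simp
  have f_div0: "f i div L = row n \<pi> (R * h0) i" for i
  proof -
    have "f i = row n \<pi> (R * h0 * L) i" by (simp add: f_def h mult.assoc)
    then show ?thesis using L by (simp add: row_refine)
  qed
  have \<rho>R: "\<rho> i < R" if "i \<in> {1..n}" for i unfolding \<rho>_def using p that R by (intro row_lt) auto
  from maximal_selection[OF C(1) finX w K, of \<rho> f Q]
  obtain S1 s D I where S1: "S1 \<subseteq> C"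
    and sel: "\<forall>c\<in>S1. D c \<subseteq> \<rho> ` (X \<inter> c) \<and> rich K (\<beta>1 * n) f Q X c (D c) (s c) (I c)"
    and dist: "\<forall>c\<in>S1. \<forall>c'\<in>S1. c \<noteq> c' \<longrightarrow> (\<forall>r\<in>D c \<inter> D c'. s c r \<noteq> s c' r)"
    and lose: "\<forall>c\<in>S1. \<forall>i\<in>X \<inter> c. \<rho> i \<in> D c \<or> f i \<in> (\<Union>c\<in>S1. s c ` D c)"
    and poor: "\<forall>c\<in>C - S1. \<forall>s' I'. \<not> rich K (\<beta>1 * n) f Q {i\<in>X. f i \<notin> (\<Union>c\<in>S1. s c ` D c)} c
         (\<rho> ` ({i\<in>X. f i \<notin> (\<Union>c\<in>S1. s c ` D c)} \<inter> c)) s' I'"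
    by (elim exE conjE)
  define F where "F = (\<Union>c\<in>S1. s c ` D c)"
  define Y where "Y = {i\<in>X. f i \<notin> F}"
  have YX: "Y \<subseteq> X" by (auto simp: Y_def)
  have finS1: "finite S1" using S1 C(1) finite_subset by blast
  have DR: "D c \<subseteq> {..<R}" if "c \<in> S1" for c using sel that \<rho>R Xn by fastforce
  have "\<exists>P Y'. finite P \<and> card P \<le> K ^ d \<and> (\<forall>L\<in>P. L \<subseteq> c \<and> (\<exists>p m. L = {p..<p + m})) \<and>
     (\<forall>L\<in>P. \<forall>L'\<in>P. L \<noteq> L' \<longrightarrow> before id L L' \<or> before id L' L) \<and>
     Y' \<subseteq> Y \<inter> c \<and> Y' \<subseteq> \<Union>P \<and> (\<forall>L\<in>P. card (row n \<pi> R ` (Y' \<inter> L)) < card (\<rho> ` (Y \<inter> c))) \<and>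
     real (card (Y \<inter> c - Y')) \<le> real (K ^ d) + \<theta> * card c + real (K ^ d * (R * h)) * (\<beta>1 * n)"
    if c: "c \<in> C - S1" for c
  proof -
    obtain q m where cq: "c = {q..<q + m}" using C(3) c by blast
    have cn: "c \<subseteq> {1..n}" using C(3) c by blast
    show ?thesis
    proof (rule split_column[OF p cq cn K h1 R _ _ _ d])
      show "\<beta>1 \<ge> 0" using pos by simp
      show "\<rho> ` (Y \<inter> c) = row n \<pi> R ` (Y \<inter> c)" by (simp add: \<rho>_def)
      show "\<not> (\<exists>p m. {p..<p + K * m} \<subseteq> c \<and> (\<forall>r\<in>\<rho> ` (Y \<inter> c). \<exists>s<R * h. s div h = r \<and>
       (\<forall>a<K. \<beta>1 * n \<le> real (card {i\<in>Y \<inter> {p + a * m..<p + (a + 1) * m}. row n \<pi> (R * h) i = s}))))"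
      proof
        assume "\<exists>p m. {p..<p + K * m} \<subseteq> c \<and> (\<forall>r\<in>\<rho> ` (Y \<inter> c). \<exists>s<R * h. s div h = r \<and>
       (\<forall>a<K. \<beta>1 * n \<le> real (card {i\<in>Y \<inter> {p + a * m..<p + (a + 1) * m}. row n \<pi> (R * h) i = s})))"
        then obtain q m where q: "{q..<q + K * m} \<subseteq> c" "\<forall>r\<in>\<rho> ` (Y \<inter> c). \<exists>s<R * h. s div h = r \<and>
       (\<forall>a<K. \<beta>1 * n \<le> real (card {i\<in>Y \<inter> {q + a * m..<q + (a + 1) * m}. row n \<pi> (R * h) i = s}))"
          by (elim exE conjE)
        from bchoice[OF q(2)] obtain s' where s': "\<forall>r\<in>\<rho> ` (Y \<inter> c). s' r < R * h \<and> s' r div h = r \<and>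
       (\<forall>a<K. \<beta>1 * n \<le> real (card {i\<in>Y \<inter> {q + a * m..<q + (a + 1) * m}. row n \<pi> (R * h) i = s' r}))"
          by (elim exE)
        have "rich K (\<beta>1 * n) f Q Y c (\<rho> ` (Y \<inter> c)) s' (\<lambda>a. {q + a * m..<q + (a + 1) * m})"
          unfolding rich_def
        proof (intro conjI allI impI ballI)
          fix a assume "a < K"
          then have "(a + 1) * m \<le> K * m" by (intro mult_le_mono1) simp
          then have "{q + a * m..<q + (a + 1) * m} \<subseteq> {q..<q + K * m}" by auto
          then show "{q + a * m..<q + (a + 1) * m} \<subseteq> c" using q(1) by blast
        next
          fix a b assume "a < b \<and> b < K"
          then show "before id {q + a * m..<q + (a + 1) * m} {q + b * m..<q + (b + 1) * m}"
            by (intro before_intervals) simp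
        next
          fix r assume "r \<in> \<rho> ` (Y \<inter> c)"
          then have "s' r < R * h \<and> s' r div h = r" using s' by blast
          then show "s' r \<in> Q r" by (simp add: Q_def)
        next
          fix r a assume "r \<in> \<rho> ` (Y \<inter> c)" "a < K"
          then show "\<beta>1 * n \<le> real (card {i\<in>Y \<inter> {q + a * m..<q + (a + 1) * m}. f i = s' r})"
            using s' unfolding f_def by blast
        qed
        then show False using poor c unfolding Y_def F_def by blast
      qed
    qed
  qed
  then have "\<forall>c\<in>C - S1. \<exists>P Y'. finite P \<and> card P \<le> K ^ d \<and> (\<forall>L\<in>P. L \<subseteq> c \<and> (\<exists>p m. L = {p..<p + m})) \<and>
     (\<forall>L\<in>P. \<forall>L'\<in>P. L \<noteq> L' \<longrightarrow> before id L L' \<or> before id L' L) \<and>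
     Y' \<subseteq> Y \<inter> c \<and> Y' \<subseteq> \<Union>P \<and> (\<forall>L\<in>P. card (row n \<pi> R ` (Y' \<inter> L)) < card (\<rho> ` (Y \<inter> c))) \<and>
     real (card (Y \<inter> c - Y')) \<le> real (K ^ d) + \<theta> * card c + real (K ^ d * (R * h)) * (\<beta>1 * n)" by blast
  from bchoice[OF this] obtain P where "\<forall>c\<in>C - S1. \<exists>Y'. finite (P c) \<and> card (P c) \<le> K ^ d \<and> (\<forall>L\<in>P c. L \<subseteq> c \<and> (\<exists>p m. L = {p..<p + m})) \<and>
     (\<forall>L\<in>P c. \<forall>L'\<in>P c. L \<noteq> L' \<longrightarrow> before id L L' \<or> before id L' L) \<and>
     Y' \<subseteq> Y \<inter> c \<and> Y' \<subseteq> \<Union>(P c) \<and> (\<forall>L\<in>P c. card (row n \<pi> R ` (Y' \<inter> L)) < card (\<rho> ` (Y \<inter> c))) \<and>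
     real (card (Y \<inter> c - Y')) \<le> real (K ^ d) + \<theta> * card c + real (K ^ d * (R * h)) * (\<beta>1 * n)" by (elim exE)
  from bchoice[OF this] obtain Y' where PY: "\<forall>c\<in>C - S1. finite (P c) \<and> card (P c) \<le> K ^ d \<and> (\<forall>L\<in>P c. L \<subseteq> c \<and> (\<exists>p m. L = {p..<p + m})) \<and>
     (\<forall>L\<in>P c. \<forall>L'\<in>P c. L \<noteq> L' \<longrightarrow> before id L L' \<or> before id L' L) \<and>
     Y' c \<subseteq> Y \<inter> c \<and> Y' c \<subseteq> \<Union>(P c) \<and> (\<forall>L\<in>P c. card (row n \<pi> R ` (Y' c \<inter> L)) < card (\<rho> ` (Y \<inter> c))) \<and>
     real (card (Y \<inter> c - Y' c)) \<le> real (K ^ d) + \<theta> * card c + real (K ^ d * (R * h)) * (\<beta>1 * n)" by (elim exE)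
  have Pfin: "finite (P c)" and Pcard: "card (P c) \<le> K ^ d" and Y'sub: "Y' c \<subseteq> Y \<inter> c"
    and Y'P: "Y' c \<subseteq> \<Union>(P c)"
    and loss: "real (card (Y \<inter> c - Y' c)) \<le> real (K ^ d) + \<theta> * card c + real (K ^ d * (R * h)) * (\<beta>1 * n)"
    if "c \<in> C - S1" for c using bspec[OF PY that] by blast+
  have Psub: "L \<subseteq> c" and Pint: "\<exists>p m. L = {p..<p + m}"
    and Pfew: "card (row n \<pi> R ` (Y' c \<inter> L)) < card (\<rho> ` (Y \<inter> c))"
    if "c \<in> C - S1" "L \<in> P c" for c L
    using bspec[OF PY that(1)] that(2) by blast+
  have Pord: "before id L L' \<or> before id L' L" if "c \<in> C - S1" "L \<in> P c" "L' \<in> P c" "L \<noteq> L'" for c L L'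
    using bspec[OF PY that(1)] that(2-4) by blast
  define C' where "C' = (\<Union>c\<in>C - S1. P c)"
  define X1 where "X1 = (\<Union>c\<in>C - S1. Y' c)"
  have X1Y: "X1 \<subseteq> Y" using Y'sub by (auto simp: X1_def)
  have disj: "c = c'" if "c \<in> C" "c' \<in> C" "i \<in> c" "i \<in> c'" for c c' i
    using ordered_family_disjoint[OF C(4) that] .
  have C'C: "\<exists>c\<in>C - S1. L \<in> P c \<and> L \<subseteq> c" if "L \<in> C'" for L
    using that Psub unfolding C'_def by blast
  have "\<exists>S X' B. framework n \<pi> k R (\<beta>3 * n) S X' B \<and> X' \<subseteq> X1 \<and> real (card (X1 - X')) \<le> \<theta> * n \<and>
          (\<forall>c\<in>S. \<exists>c0\<in>C'. c \<subseteq> c0) \<and>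
          (\<forall>c\<in>S. \<forall>r\<in>row n \<pi> R ` (X' \<inter> c). (\<forall>a<k. B c r a \<subseteq> X1) \<and>
             (\<exists>u. \<forall>a<k. \<forall>i\<in>B c r a. row n \<pi> (R * h) i = u))"
  proof (rule IH[unfolded framework_claim_def, THEN spec, THEN spec, THEN spec, THEN mp, THEN mp, THEN mp, THEN mp, THEN mp, THEN mp, THEN mp])
    show "\<pi> permutes {1..n}" by fact
    show "finite C'" using C(1) Pfin by (auto simp: C'_def)
    have "card C' \<le> (\<Sum>c\<in>C - S1. card (P c))" unfolding C'_def using C(1) by (intro card_UN_le) simp
    also have "\<dots> \<le> (\<Sum>c\<in>C - S1. K ^ d)" using Pcard by (intro sum_mono)
    also have "\<dots> = card (C - S1) * K ^ d" by simp
    also have "\<dots> \<le> N * K ^ d" using C(1,2) card_mono[of C "C - S1"] by (intro mult_le_mono1) auto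
    finally show "card C' \<le> N * K ^ d" .
    show "\<forall>c\<in>C'. c \<subseteq> {1..n} \<and> (\<exists>p m. c = {p..<p + m})"
    proof
      fix L assume "L \<in> C'"
      then obtain c where c: "c \<in> C - S1" "L \<in> P c" "L \<subseteq> c" using C'C by blast
      then show "L \<subseteq> {1..n} \<and> (\<exists>p m. L = {p..<p + m})" using C(3)[of c] Pint[OF c(1,2)] by blast
    qed
    show "ordered_family C'"
      unfolding ordered_family_def
    proof (intro ballI impI)
      fix L L' assume LL: "L \<in> C'" "L' \<in> C'" "L \<noteq> L'"
      obtain c c' where c: "c \<in> C - S1" "L \<in> P c" "L \<subseteq> c" "c' \<in> C - S1" "L' \<in> P c'" "L' \<subseteq> c'"
        using C'C LL by meson
      show "before id L L' \<or> before id L' L"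
      proof (cases "c = c'")
        case True then show ?thesis using Pord[OF c(1,2) _ LL(3)] c by blast
      next
        case False
        then have "before id c c' \<or> before id c' c" using ordered_familyD[OF C(4)] c by blast
        then show ?thesis using before_mono[OF _ c(3) c(6)] before_mono[OF _ c(6) c(3)] by blast
      qed
    qed
    show "X1 \<subseteq> \<Union> C'" using Y'P unfolding X1_def C'_def by blast
    show "\<forall>c\<in>C'. card (row n \<pi> R ` (X1 \<inter> c)) \<le> t"
    proof
      fix L assume "L \<in> C'"
      then obtain c where c: "c \<in> C - S1" "L \<in> P c" "L \<subseteq> c" using C'C by blast
      have "X1 \<inter> L = Y' c \<inter> L"
      proof
        show "X1 \<inter> L \<subseteq> Y' c \<inter> L"
        proof
          fix i assume i: "i \<in> X1 \<inter> L"
          then obtain c' where c': "c' \<in> C - S1" "i \<in> Y' c'" by (auto simp: X1_def)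
          then have "i \<in> c'" using Y'sub by blast
          then have "c' = c" using disj[of c' c i] c c' i by blast
          then show "i \<in> Y' c \<inter> L" using c' i by blast
        qed
        show "Y' c \<inter> L \<subseteq> X1 \<inter> L" using c by (auto simp: X1_def)
      qed
      then have "card (row n \<pi> R ` (X1 \<inter> L)) < card (\<rho> ` (Y \<inter> c))" using Pfew[OF c(1,2)] by simp
      also have "\<dots> \<le> card (row n \<pi> R ` (X \<inter> c))" unfolding \<rho>_def using YX finX by (intro card_mono) auto
      also have "\<dots> \<le> Suc t" using X(2) c by blast
      finally show "card (row n \<pi> R ` (X1 \<inter> L)) \<le> t" by simp
    qed
  qed
  then obtain S2 X2 B2 where fw: "framework n \<pi> k R (\<beta>3 * n) S2 X2 B2" and X2: "X2 \<subseteq> X1"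
    and l2: "real (card (X1 - X2)) \<le> \<theta> * n" and S2: "\<forall>c\<in>S2. \<exists>c0\<in>C'. c \<subseteq> c0"
    and B2: "\<forall>c\<in>S2. \<forall>r\<in>row n \<pi> R ` (X2 \<inter> c). (\<forall>a<k. B2 c r a \<subseteq> X1) \<and>
             (\<exists>u. \<forall>a<k. \<forall>i\<in>B2 c r a. row n \<pi> (R * h) i = u)" by (elim exE conjE)
  have "\<forall>c\<in>S1. \<exists>B. boxes \<pi> k (\<beta>2 * n) (D c) B \<and> (\<forall>r\<in>D c. \<forall>a<k. B r a \<subseteq> {i\<in>X \<inter> c. f i = s c r})"
  proof
    fix c assume c: "c \<in> S1"
    have r: "rich K (\<beta>1 * n) f Q X c (D c) (s c) (I c)" using sel c by blast
    define W where "W r a = {i\<in>X \<inter> I c a. f i = s c r}" for r a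
    have "\<exists>B. boxes \<pi> k (\<beta>2 * n) (D c) B \<and> (\<forall>r\<in>D c. \<forall>a<k. B r a \<subseteq> (\<Union>b<K. W r b))"
    proof (rule box[OF DR[OF c]])
      show "\<forall>r\<in>D c. \<forall>a<K. W r a \<subseteq> {1..n} \<and> \<beta>1 * real n \<le> real (card (W r a))"
        using r Xn unfolding rich_def W_def by blast
      show "\<forall>r\<in>D c. \<forall>r'\<in>D c. \<forall>a b. a < b \<and> b < K \<longrightarrow> before id (W r a) (W r' b)"
        using r unfolding rich_def W_def by (blast intro: before_mono)
    qed
    moreover have "(\<Union>b<K. W r b) \<subseteq> {i\<in>X \<inter> c. f i = s c r}" for r
      using r unfolding rich_def W_def by blast
    ultimately show "\<exists>B. boxes \<pi> k (\<beta>2 * n) (D c) B \<and> (\<forall>r\<in>D c. \<forall>a<k. B r a \<subseteq> {i\<in>X \<inter> c. f i = s c r})"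
      by (meson order.trans)
  qed
  from bchoice[OF this] obtain B1 where B1: "\<forall>c\<in>S1. boxes \<pi> k (\<beta>2 * n) (D c) (B1 c) \<and>
     (\<forall>r\<in>D c. \<forall>a<k. B1 c r a \<subseteq> {i\<in>X \<inter> c. f i = s c r})" by (elim exE)
  define X' where "X' = {i\<in>X. \<exists>c\<in>S1. i \<in> c \<and> \<rho> i \<in> D c} \<union> X2"
  \<comment> \<open>Only the empty set can be a member of both \<open>S1\<close> and \<open>S2\<close>; it has no cells, so its boxes are irrelevant.\<close>
  define B where "B c = (if c \<in> S1 then B1 c else B2 c)" for c
  have X2C: "\<exists>c\<in>C - S1. i \<in> c" if "i \<in> X2" for i using that X2 Y'sub unfolding X1_def by blast
  have S2C: "\<exists>c0\<in>C - S1. c \<subseteq> c0" if "c \<in> S2" for c using that S2 C'C by (meson order.trans)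
  have row1: "\<rho> ` (X' \<inter> c) \<subseteq> D c" if c: "c \<in> S1" for c
  proof
    fix r assume "r \<in> \<rho> ` (X' \<inter> c)"
    then obtain i where i: "i \<in> X'" "i \<in> c" "r = \<rho> i" by blast
    have "i \<notin> X2"
      using X2C[of i] disj[of _ c i] i(2) c S1 by blast
    then obtain c' where "c' \<in> S1" "i \<in> c'" "\<rho> i \<in> D c'" using i(1) by (auto simp: X'_def)
    then show "r \<in> D c" using disj[of c' c i] i S1 c by auto
  qed
  have row2: "X' \<inter> c \<subseteq> X2 \<inter> c" if c: "c \<in> S2" for c
  proof
    fix i assume i: "i \<in> X' \<inter> c"
    obtain c0 where c0: "c0 \<in> C - S1" "c \<subseteq> c0" using S2C[OF c] by blast
    have "\<not> (\<exists>c\<in>S1. i \<in> c)" using disj[of _ c0 i] c0 i S1 by blast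
    then show "i \<in> X2 \<inter> c" using i by (auto simp: X'_def)
  qed
  have box1: "i \<in> X \<and> i \<in> c \<and> f i = s c r" if "c \<in> S1" "r \<in> D c" "a < k" "i \<in> B c r a" for c r a i
    using B1 that by (auto simp: B_def)
  have box2: "i \<in> X1" if "c \<in> S2" "c \<notin> S1" "r \<in> \<rho> ` (X' \<inter> c)" "a < k" "i \<in> B c r a" for c r a i
    using B2 that row2[OF that(1)] unfolding B_def \<rho>_def by (simp add: image_iff) blast
  have box2': "\<exists>u. \<forall>a<k. \<forall>i\<in>B c r a. f i = u" if "c \<in> S2" "c \<notin> S1" "r \<in> \<rho> ` (X' \<inter> c)" for c r
  proof -
    have "r \<in> row n \<pi> R ` (X2 \<inter> c)" using that row2[OF that(1)] unfolding \<rho>_def by blast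
    then have "\<exists>u. \<forall>a<k. \<forall>i\<in>B2 c r a. f i = u" using B2 that(1) unfolding f_def by blast
    then show ?thesis using that(2) by (simp add: B_def)
  qed
  have s\<rho>: "s c r div h = r" if "c \<in> S1" "r \<in> D c" for c r
    using sel that unfolding rich_def Q_def by blast
  have cross: "before \<pi> (\<Union>a<k. B c r a) (\<Union>a<k. B c' r a) \<or> before \<pi> (\<Union>a<k. B c' r a) (\<Union>a<k. B c r a)"
    if "c \<in> S1" "c' \<in> S2" "c' \<notin> S1" "r \<in> \<rho> ` (X' \<inter> c)" "r \<in> \<rho> ` (X' \<inter> c')" for c c' r
  proof -
    have rD: "r \<in> D c" using row1 that by blast
    from box2'[OF that(2,3,5)] obtain u where u: "\<forall>a<k. \<forall>i\<in>B c' r a. f i = u" by blast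
    show ?thesis
    proof (cases "(\<Union>a<k. B c' r a) = {}")
      case True then show ?thesis by (simp only: True) (simp add: before_def)
    next
      case False
      then obtain a i where i: "a < k" "i \<in> B c' r a" by blast
      then have "i \<in> Y" using box2[OF that(2,3,5)] X1Y by blast
      \<comment> \<open>The boxes of \<open>c'\<close> avoid the fine rows in \<open>F\<close>, whereas those of \<open>c\<close> lie in one of them.\<close>
      then have "u \<notin> F" using u i by (auto simp: Y_def)
      moreover have "s c r \<in> F" using that(1) rD by (auto simp: F_def)
      ultimately have ne: "s c r \<noteq> u" by blast
      show ?thesis
      proof (rule before_rows[OF _ _ ne])
        show "row n \<pi> (R * h) i = s c r" if "i \<in> (\<Union>a<k. B c r a)" for i
          using box1[OF \<open>c \<in> S1\<close> rD] that by (auto simp: f_def)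
        show "row n \<pi> (R * h) i = u" if "i \<in> (\<Union>a<k. B c' r a)" for i
          using u that by (auto simp: f_def)
      qed
    qed
  qed
  have fwX2: "ordered_family S2" "X2 \<subseteq> \<Union>S2" 
    "\<forall>c\<in>S2. boxes \<pi> k (\<beta>3 * n) (row n \<pi> R ` (X2 \<inter> c)) (B2 c)"
    "\<forall>c\<in>S2. \<forall>r\<in>row n \<pi> R ` (X2 \<inter> c). \<forall>a<k. B2 c r a \<subseteq> c \<inter> {i\<in>{1..n}. row n \<pi> R i = r}"
    "\<forall>c\<in>S2. \<forall>c'\<in>S2. c \<noteq> c' \<longrightarrow> (\<forall>r\<in>row n \<pi> R ` (X2 \<inter> c) \<inter> row n \<pi> R ` (X2 \<inter> c').
        before \<pi> (\<Union>a<k. B2 c r a) (\<Union>a<k. B2 c' r a) \<or> before \<pi> (\<Union>a<k. B2 c' r a) (\<Union>a<k. B2 c r a))"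
    using fw unfolding framework_def by blast+
  have wle: "\<beta> * real n \<le> \<beta>2 * real n" "\<beta> * real n \<le> \<beta>3 * real n"
    using pos by (simp_all add: mult_right_mono)
  have "framework n \<pi> k R (\<beta> * n) (S1 \<union> S2) X' B"
    unfolding framework_def \<rho>_def[symmetric]
  proof (intro conjI ballI allI impI)
    show "ordered_family (S1 \<union> S2)"
      unfolding ordered_family_def
    proof (intro ballI impI)
      have mixed: "before id c c' \<or> before id c' c" if c: "c \<in> S1" "c' \<in> S2" for c c'
      proof -
        obtain c0 where c0: "c0 \<in> C - S1" "c' \<subseteq> c0" using S2C[OF c(2)] by blast
        then have "c \<in> C" "c0 \<in> C" "c \<noteq> c0" using S1 c(1) by auto
        then have "before id c c0 \<or> before id c0 c" by (rule ordered_familyD[OF C(4)])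
        then show ?thesis using before_mono[OF _ order.refl c0(2)] before_mono[OF _ c0(2) order.refl] by blast
      qed
      fix c c' assume cc: "c \<in> S1 \<union> S2" "c' \<in> S1 \<union> S2" "c \<noteq> c'"
      show "before id c c' \<or> before id c' c"
      proof (cases "c \<in> S1")
        case c1: True
        show ?thesis
        proof (cases "c' \<in> S1")
          case True
          then have "c \<in> C" "c' \<in> C" using S1 c1 by auto
          then show ?thesis using cc(3) by (rule ordered_familyD[OF C(4)])
        next
          case False then show ?thesis using mixed[OF c1, of c'] cc by simp
        qed
      next
        case c1: False
        show ?thesis
        proof (cases "c' \<in> S1")
          case True then show ?thesis using mixed[of c' c] cc c1 by auto
        next
          case False
          then show ?thesis using ordered_familyD[OF fwX2(1) _ _ cc(3)] cc c1 by simp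
        qed
      qed
    qed
    show "X' \<subseteq> \<Union> (S1 \<union> S2)" using fwX2(2) unfolding X'_def by blast
  next
    fix c assume c: "c \<in> S1 \<union> S2"
    show "boxes \<pi> k (\<beta> * n) (\<rho> ` (X' \<inter> c)) (B c)"
    proof (cases "c \<in> S1")
      case True
      then have "boxes \<pi> k (\<beta>2 * n) (D c) (B c)" using B1 by (simp add: B_def)
      then show ?thesis using wle(1) row1[OF True] by (rule boxes_mono)
    next
      case False
      then have c2: "c \<in> S2" using c by blast
      then have "boxes \<pi> k (\<beta>3 * n) (row n \<pi> R ` (X2 \<inter> c)) (B c)" using fwX2(3) False by (simp add: B_def)
      then show ?thesis using wle(2)
        by (rule boxes_mono) (use row2[OF c2] in \<open>auto simp: \<rho>_def\<close>)
    qed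
  next
    fix c r a assume c: "c \<in> S1 \<union> S2" and r: "r \<in> \<rho> ` (X' \<inter> c)" and a: "a < k"
    show "B c r a \<subseteq> c \<inter> {i\<in>{1..n}. \<rho> i = r}"
    proof (cases "c \<in> S1")
      case True
      have rD: "r \<in> D c" using row1 True r by blast
      show ?thesis
      proof
        fix i assume i: "i \<in> B c r a"
        have "\<rho> i = r" using box1[OF True rD a i] s\<rho>[OF True rD] f_div[of i] by simp
        then show "i \<in> c \<inter> {i\<in>{1..n}. \<rho> i = r}" using box1[OF True rD a i] Xn by blast
      qed
    next
      case False
      then have c2: "c \<in> S2" using c by blast
      then have "r \<in> row n \<pi> R ` (X2 \<inter> c)" using r row2[OF c2] unfolding \<rho>_def by blast
      then have "B2 c r a \<subseteq> c \<inter> {i\<in>{1..n}. \<rho> i = r}" using fwX2(4) c2 a unfolding \<rho>_def by blast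
      then show ?thesis using False by (simp only: B_def if_False)
    qed
  next
    fix c c' r assume c: "c \<in> S1 \<union> S2" "c' \<in> S1 \<union> S2" "c \<noteq> c'" and r: "r \<in> \<rho> ` (X' \<inter> c) \<inter> \<rho> ` (X' \<inter> c')"
    show "before \<pi> (\<Union>a<k. B c r a) (\<Union>a<k. B c' r a) \<or> before \<pi> (\<Union>a<k. B c' r a) (\<Union>a<k. B c r a)"
    proof (cases "c \<in> S1"; cases "c' \<in> S1")
      assume cc: "c \<in> S1" "c' \<in> S1"
      have rD: "r \<in> D c" "r \<in> D c'" using row1 cc r by blast+
      have ne: "s c r \<noteq> s c' r" using dist cc c(3) rD by blast
      show ?thesis
      proof (rule before_rows[OF _ _ ne])
        show "row n \<pi> (R * h) i = s c r" if "i \<in> (\<Union>a<k. B c r a)" for i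
          using box1[OF cc(1) rD(1)] that by (auto simp: f_def)
        show "row n \<pi> (R * h) i = s c' r" if "i \<in> (\<Union>a<k. B c' r a)" for i
          using box1[OF cc(2) rD(2)] that by (auto simp: f_def)
      qed
    next
      assume cc: "c \<in> S1" "c' \<notin> S1"
      then show ?thesis using cross[of c c' r] c r by blast
    next
      assume cc: "c \<notin> S1" "c' \<in> S1"
      then show ?thesis using cross[of c' c r] c r by blast
    next
      assume cc: "c \<notin> S1" "c' \<notin> S1"
      then have c2: "c \<in> S2" "c' \<in> S2" using c by blast+
      have "r \<in> row n \<pi> R ` (X2 \<inter> c) \<inter> row n \<pi> R ` (X2 \<inter> c')"
        using r row2[OF c2(1)] row2[OF c2(2)] unfolding \<rho>_def by blast
      then have "before \<pi> (\<Union>a<k. B2 c r a) (\<Union>a<k. B2 c' r a) \<or> before \<pi> (\<Union>a<k. B2 c' r a) (\<Union>a<k. B2 c r a)"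
        using fwX2(5) c2 c(3) by blast
      then show ?thesis using cc by (simp only: B_def if_False)
    qed
  qed
  moreover have "X' \<subseteq> X" using X2 X1Y YX by (auto simp: X'_def)
  moreover have "real (card (X - X')) \<le> 5 * \<theta> * n"
  proof -
    have cov: "X - X' \<subseteq> (\<Union>u\<in>F. {i\<in>{1..n}. f i = u}) \<union> (\<Union>c\<in>C - S1. Y \<inter> c - Y' c) \<union> (X1 - X2)"
    proof
      fix i assume i: "i \<in> X - X'"
      then obtain c where c: "c \<in> C" "i \<in> c" using X(1) by blast
      have inn: "i \<in> {1..n}" using i Xn by blast
      show "i \<in> (\<Union>u\<in>F. {i\<in>{1..n}. f i = u}) \<union> (\<Union>c\<in>C - S1. Y \<inter> c - Y' c) \<union> (X1 - X2)"
      proof (cases "f i \<in> F")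
        case True then show ?thesis using inn by blast
      next
        case False
        then have iY: "i \<in> Y" using i by (simp add: Y_def)
        have "c \<notin> S1"
        proof
          assume cS: "c \<in> S1"
          have "i \<in> X \<inter> c" using i c by blast
          then have "\<rho> i \<in> D c" using lose cS False unfolding F_def by blast
          then show False using i c cS by (auto simp: X'_def)
        qed
        then have c': "c \<in> C - S1" using c by blast
        show ?thesis
        proof (cases "i \<in> Y' c")
          case True
          then have "i \<in> X1" using c' by (auto simp: X1_def)
          moreover have "i \<notin> X2" using i by (simp add: X'_def)
          ultimately show ?thesis by blast
        next
          case False then show ?thesis using c' iY c(2) by blast
        qed
      qed
    qed
    have finF: "finite F" unfolding F_def using finS1 by (intro finite_UN_I finite_imageI finite_subset[OF DR]) auto
    have finYc: "finite Y" "finite X1" using finite_subset[OF YX finX] finite_subset[OF order.trans[OF X1Y YX] finX] by auto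
    have "card (X - X') \<le> card ((\<Union>u\<in>F. {i\<in>{1..n}. f i = u}) \<union> (\<Union>c\<in>C - S1. Y \<inter> c - Y' c) \<union> (X1 - X2))"
      using finF finYc C(1) by (intro card_mono[OF _ cov]) auto
    also have "\<dots> \<le> card (\<Union>u\<in>F. {i\<in>{1..n}. f i = u}) + card (\<Union>c\<in>C - S1. Y \<inter> c - Y' c) + card (X1 - X2)"
      by (intro order.trans[OF card_Un_le] add_mono card_Un_le order_refl)
    also have "\<dots> \<le> (\<Sum>u\<in>F. card {i\<in>{1..n}. f i = u}) + (\<Sum>c\<in>C - S1. card (Y \<inter> c - Y' c)) + card (X1 - X2)"
      using finF C(1) by (intro add_mono card_UN_le) auto
    finally have "real (card (X - X')) \<le> real ((\<Sum>u\<in>F. card {i\<in>{1..n}. f i = u}) + (\<Sum>c\<in>C - S1. card (Y \<inter> c - Y' c)) + card (X1 - X2))"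
      by (rule of_nat_mono)
    also have "\<dots> = (\<Sum>u\<in>F. real (card {i\<in>{1..n}. f i = u})) + (\<Sum>c\<in>C - S1. real (card (Y \<inter> c - Y' c))) + real (card (X1 - X2))"
      by (simp only: of_nat_add of_nat_sum)
    finally have total: "real (card (X - X')) \<le> (\<Sum>u\<in>F. real (card {i\<in>{1..n}. f i = u})) + (\<Sum>c\<in>C - S1. real (card (Y \<inter> c - Y' c))) + real (card (X1 - X2))" .
    have t1: "(\<Sum>u\<in>F. real (card {i\<in>{1..n}. f i = u})) \<le> \<theta> * n"
    proof -
      have "card F \<le> (\<Sum>c\<in>S1. card (s c ` D c))" unfolding F_def by (rule card_UN_le[OF finS1])
      also have "\<dots> \<le> (\<Sum>c\<in>S1. R)"
      proof (rule sum_mono)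
        fix c assume "c \<in> S1"
        then have "card (D c) \<le> R" "finite (D c)" using card_mono[OF _ DR] finite_subset[OF DR] by auto
        then show "card (s c ` D c) \<le> R" using card_image_le[of "D c" "s c"] by linarith
      qed
      also have "\<dots> \<le> N * R" using card_mono[OF C(1) S1] C(2) by simp
      finally have F: "card F \<le> N * R" .
      have "(\<Sum>u\<in>F. real (card {i\<in>{1..n}. f i = u})) \<le> (\<Sum>u\<in>F. n / real (R * h) + 1)"
        unfolding f_def using R h1 by (intro sum_mono card_row_le p) simp
      also have "\<dots> = real (card F) * (n / real (R * h) + 1)" by simp
      also have "\<dots> \<le> real (N * R) * (n / real (R * h) + 1)" using F by (intro mult_right_mono) (simp_all only: of_nat_le_iff, simp)
      finally show ?thesis using small(1) by linarith
    qed
    have t2: "(\<Sum>c\<in>C - S1. real (card (Y \<inter> c - Y' c))) \<le> 3 * \<theta> * n"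
    proof -
      have cN: "card (C - S1) \<le> N" using C(1,2) card_mono[of C "C - S1"] by auto
      have of: "ordered_family (C - S1)" using C(4) unfolding ordered_family_def by simp
      have sumc: "(\<Sum>c\<in>C - S1. card c) \<le> n" using C(1,3) by (intro ordered_family_card[OF of]) auto
      have "(\<Sum>c\<in>C - S1. real (card (Y \<inter> c - Y' c))) \<le> (\<Sum>c\<in>C - S1. real (K ^ d) + \<theta> * card c + real (K ^ d * (R * h)) * (\<beta>1 * n))"
        using loss by (intro sum_mono)
      also have "\<dots> = real (card (C - S1)) * real (K ^ d) + \<theta> * real (\<Sum>c\<in>C - S1. card c)
          + real (card (C - S1)) * (real (K ^ d * (R * h)) * (\<beta>1 * n))"
        by (simp add: sum.distrib sum_distrib_left)
      also have "\<dots> \<le> real N * real (K ^ d) + \<theta> * real n + real N * (real (K ^ d * (R * h)) * (\<beta>1 * n))"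
        using cN sumc pos by (intro add_mono mult_right_mono mult_left_mono) (simp_all only: of_nat_le_iff, simp_all)
      also have "real N * (real (K ^ d * (R * h)) * (\<beta>1 * n)) = real (N * (K ^ d * (R * h))) * \<beta>1 * n" by simp
      also have "\<dots> \<le> \<theta> * n" using small(3) by (intro mult_right_mono) simp_all
      also have "real N * real (K ^ d) = real (N * K ^ d)" by simp
      finally show ?thesis using small(2) by linarith
    qed
    show ?thesis using total t1 t2 l2 by linarith
  qed
  moreover have "\<forall>c\<in>S1 \<union> S2. \<exists>c0\<in>C. c \<subseteq> c0" using S1 S2C by blast
  moreover have "\<forall>c\<in>S1 \<union> S2. \<forall>r\<in>row n \<pi> R ` (X' \<inter> c). (\<forall>a<k. B c r a \<subseteq> X) \<and>
             (\<exists>u. \<forall>a<k. \<forall>i\<in>B c r a. row n \<pi> (R * h0) i = u)"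
    unfolding \<rho>_def[symmetric]
  proof (intro ballI)
    fix c r assume c: "c \<in> S1 \<union> S2" and r: "r \<in> \<rho> ` (X' \<inter> c)"
    show "(\<forall>a<k. B c r a \<subseteq> X) \<and> (\<exists>u. \<forall>a<k. \<forall>i\<in>B c r a. row n \<pi> (R * h0) i = u)"
    proof (cases "c \<in> S1")
      case True
      have rD: "r \<in> D c" using row1 True r by blast
      have "\<forall>a<k. \<forall>i\<in>B c r a. row n \<pi> (R * h0) i = s c r div L"
        using box1[OF True rD] f_div0 by metis
      then show ?thesis using box1[OF True rD] by blast
    next
      case False
      then have c2: "c \<in> S2" using c by blast
      obtain u where "\<forall>a<k. \<forall>i\<in>B c r a. f i = u" using box2'[OF c2 False r] by blast
      then have "\<forall>a<k. \<forall>i\<in>B c r a. row n \<pi> (R * h0) i = u div L" using f_div0 by metis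
      then show ?thesis using box2[OF c2 False r] X1Y YX by blast
    qed
  qed
  ultimately show ?thesis
    by (intro exI[of _ "S1 \<union> S2"] exI[of _ X'] exI[of _ B]) (intro conjI; assumption)
qed

lemma framework_exists:
  fixes k R t N h0 :: nat and \<theta> :: real
  assumes R: "R \<ge> 1" and "\<theta> > 0" "h0 \<ge> 1"
  shows "\<exists>\<beta>>0. \<exists>n0. \<forall>n\<ge>n0. framework_claim k R t \<theta> N h0 \<beta> n"
  using assms(2,3)
proof (induction t arbitrary: \<theta> N h0)
  case 0
  show ?case
  proof (intro exI[of _ "1::real"] exI[of _ 0] conjI allI impI)
    fix n :: nat
    show "framework_claim k R 0 \<theta> N h0 1 n"
      unfolding framework_claim_def
    proof (intro allI impI)
      fix \<pi> C X
      assume a: "\<forall>c\<in>C. c \<subseteq> {1..n} \<and> (\<exists>p m. c = {p..<p + m})" "X \<subseteq> \<Union> C" "\<forall>c\<in>C. card (row n \<pi> R ` (X \<inter> c)) \<le> 0"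
      have "X \<inter> c = {}" if "c \<in> C" for c
      proof -
        have "finite c" using a(1) that finite_subset[of c "{1..n}"] by simp
        then have "finite (row n \<pi> R ` (X \<inter> c))" by simp
        moreover have "card (row n \<pi> R ` (X \<inter> c)) = 0" using a(3) that by blast
        ultimately show ?thesis by (simp only: card_eq_0_iff image_is_empty simp_thms)
      qed
      then have "X = {}" using a(2) by blast
      moreover have "framework n \<pi> k R (1 * real n) {} {} B" for B by (simp add: framework_def ordered_family_def)
      ultimately show "\<exists>S X' B. framework n \<pi> k R (1 * real n) S X' B \<and> X' \<subseteq> X \<and> real (card (X - X')) \<le> \<theta> * n \<and>
          (\<forall>c\<in>S. \<exists>c0\<in>C. c \<subseteq> c0) \<and>
          (\<forall>c\<in>S. \<forall>r\<in>row n \<pi> R ` (X' \<inter> c). (\<forall>a<k. B c r a \<subseteq> X) \<and>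
             (\<exists>u. \<forall>a<k. \<forall>i\<in>B c r a. row n \<pi> (R * h0) i = u))"
        using \<open>\<theta> > 0\<close> by (intro exI[of _ "{}"] exI[of _ "\<lambda>_ _ _. {}"]) simp
    qed
  qed simp
next
  case (Suc t)
  \<comment> \<open>Each constant depends on the preceding ones only: the number \<open>R * h\<close> of fine rows, then the
    depth \<open>d\<close> of the splitting, then the density \<open>\<beta>1\<close> required of a fine row.\<close>
  define \<eta> where "\<eta> = \<theta> / 5"
  have \<eta>: "\<eta> > 0" using Suc.prems by (simp add: \<eta>_def)
  obtain K :: nat where K: "K \<ge> 1" and Kbox: "\<forall>\<beta>>(0::real). \<exists>\<beta>'>(0::real). \<exists>n0. \<forall>n\<ge>n0. \<forall>\<pi>. \<pi> permutes {1..n} \<longrightarrow> (\<forall>W. \<forall>D\<subseteq>{..<R}.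
     (\<forall>r\<in>D. \<forall>a<K. W r a \<subseteq> {1..n} \<and> \<beta> * real n \<le> real (card (W r a))) \<longrightarrow>
     (\<forall>r\<in>D. \<forall>r'\<in>D. \<forall>a b. a < b \<and> b < K \<longrightarrow> before id (W r a) (W r' b)) \<longrightarrow>
     (\<exists>B. boxes \<pi> k (\<beta>' * n) D B \<and> (\<forall>r\<in>D. \<forall>a<k. B r a \<subseteq> (\<Union>b<K. W r b))))"
    using boxes_exist[of R k] by (elim exE conjE)
  obtain L0 :: nat where L0: "2 * real N / \<eta> \<le> L0" using real_arch_simple by blast
  define L where "L = Suc L0"
  define h where "h = h0 * L"
  obtain d0 :: nat where d0: "real (K * (R * h)) / \<eta> \<le> d0" using real_arch_simple by blast
  define d where "d = Suc d0"
  define M where "M = real (N * (K ^ d * (R * h)))"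
  define \<beta>1 where "\<beta>1 = \<eta> / (M + 1)"
  have M: "M \<ge> 0" by (simp add: M_def)
  have \<beta>1: "\<beta>1 > 0" using \<eta> M by (simp add: \<beta>1_def)
  have h1: "h \<ge> 1" using Suc.prems by (simp add: h_def L_def)
  obtain \<beta>2 n2 where \<beta>2: "\<beta>2 > (0::real)" and box: "\<forall>n\<ge>n2. \<forall>\<pi>. \<pi> permutes {1..n} \<longrightarrow> (\<forall>W. \<forall>D\<subseteq>{..<R}.
     (\<forall>r\<in>D. \<forall>a<K. W r a \<subseteq> {1..n} \<and> \<beta>1 * real n \<le> real (card (W r a))) \<longrightarrow>
     (\<forall>r\<in>D. \<forall>r'\<in>D. \<forall>a b. a < b \<and> b < K \<longrightarrow> before id (W r a) (W r' b)) \<longrightarrow>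
     (\<exists>B. boxes \<pi> k (\<beta>2 * n) D B \<and> (\<forall>r\<in>D. \<forall>a<k. B r a \<subseteq> (\<Union>b<K. W r b))))"
    using Kbox[THEN spec, THEN mp, OF \<beta>1] by (elim exE conjE)
  obtain \<beta>3 n3 where \<beta>3: "\<beta>3 > (0::real)" and IH: "\<forall>n\<ge>n3. framework_claim k R t \<eta> (N * K ^ d) h \<beta>3 n"
    using Suc.IH[OF \<eta> h1, of "N * K ^ d"] by (elim exE conjE)
  obtain n4 :: nat where n4: "2 * real (N * R) / \<eta> \<le> n4" using real_arch_simple by blast
  obtain n5 :: nat where n5: "real (N * K ^ d) / \<eta> \<le> n5" using real_arch_simple by blast
  define n0 where "n0 = Suc (n2 + n3 + n4 + n5)"
  show ?case
  proof (intro exI[of _ "min \<beta>2 \<beta>3"] exI[of _ n0] conjI allI impI)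
    show "min \<beta>2 \<beta>3 > 0" using \<beta>2 \<beta>3 by simp
    fix n assume n: "n \<ge> n0"
    have nn: "n \<ge> 1" "n \<ge> n2" "n \<ge> n3" "n \<ge> n4" "n \<ge> n5" using n by (auto simp: n0_def)
    have s1: "real (N * R) * (n / real (R * h) + 1) \<le> \<eta> * n"
    proof -
      have "1 * L0 \<le> h0 * L" using Suc.prems(2) by (intro mult_le_mono) (auto simp: L_def)
      then have "real L0 \<le> real h" unfolding h_def by (simp only: of_nat_le_iff mult_1)
      then have "2 * real N / \<eta> \<le> real h" using L0 by linarith
      then have "2 * real N \<le> \<eta> * real h" using \<eta> by (simp add: field_simps)
      then have "2 * real N * n \<le> \<eta> * real h * n" by (intro mult_right_mono) auto
      then have "real N * n / h \<le> \<eta> * n / 2" using h1 by (simp add: field_simps)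
      moreover have "real (N * R) * (n / real (R * h)) = real N * n / h" using R by simp
      moreover have "real (N * R) \<le> \<eta> * n / 2"
      proof -
        have "2 * real (N * R) / \<eta> \<le> n" using n4 nn(4) by linarith
        then show ?thesis using \<eta> by (simp add: field_simps)
      qed
      ultimately show ?thesis unfolding distrib_left mult_1_right by linarith
    qed
    have s2: "real (N * K ^ d) \<le> \<eta> * n"
    proof -
      have "real (N * K ^ d) / \<eta> \<le> n" using n5 nn(5) by linarith
      then show ?thesis using \<eta> by (simp add: field_simps)
    qed
    have s3: "real (N * (K ^ d * (R * h))) * \<beta>1 \<le> \<eta>"
      unfolding M_def[symmetric] \<beta>1_def using \<eta> M by (simp add: field_simps)
    have dd: "real (K * (R * h)) \<le> \<eta> * d"
    proof -
      have "real (K * (R * h)) / \<eta> \<le> d" using d0 by (simp add: d_def)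
      then show ?thesis using \<eta> by (simp add: field_simps)
    qed
    show "framework_claim k R (Suc t) \<theta> N h0 (min \<beta>2 \<beta>3) n"
      unfolding framework_claim_def
    proof (intro allI impI)
      fix \<pi> C X
      assume a: "\<pi> permutes {1..n}" "finite C" "card C \<le> N" "\<forall>c\<in>C. c \<subseteq> {1..n} \<and> (\<exists>p m. c = {p..<p + m})"
        "ordered_family C" "X \<subseteq> \<Union> C" "\<forall>c\<in>C. card (row n \<pi> R ` (X \<inter> c)) \<le> Suc t"
      have five: "5 * \<eta> * n = \<theta> * n" by (simp add: \<eta>_def)
      show "\<exists>S X' B. framework n \<pi> k R (min \<beta>2 \<beta>3 * n) S X' B \<and> X' \<subseteq> X \<and> real (card (X - X')) \<le> \<theta> * n \<and>
          (\<forall>c\<in>S. \<exists>c0\<in>C. c \<subseteq> c0) \<and>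
          (\<forall>c\<in>S. \<forall>r\<in>row n \<pi> R ` (X' \<inter> c). (\<forall>a<k. B c r a \<subseteq> X) \<and>
             (\<exists>u. \<forall>a<k. \<forall>i\<in>B c r a. row n \<pi> (R * h0) i = u))"
        unfolding five[symmetric]
      proof (rule framework_step[where ?\<beta>1.0 = \<beta>1 and ?\<beta>2.0 = \<beta>2 and ?\<beta>3.0 = \<beta>3 and K = K and d = d and L = L and h = h and N = N and t = t])
        show "\<exists>B. boxes \<pi> k (\<beta>2 * n) D B \<and> (\<forall>r\<in>D. \<forall>a<k. B r a \<subseteq> (\<Union>b<K. W r b))"
          if "D \<subseteq> {..<R}" "\<forall>r\<in>D. \<forall>a<K. W r a \<subseteq> {1..n} \<and> \<beta>1 * real n \<le> real (card (W r a))"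
            "\<forall>r\<in>D. \<forall>r'\<in>D. \<forall>a b. a < b \<and> b < K \<longrightarrow> before id (W r a) (W r' b)" for W D
          by (rule box[THEN spec, THEN mp, OF nn(2), THEN spec, THEN mp, OF a(1), THEN spec, THEN spec, THEN mp, OF that(1), THEN mp, OF that(2), THEN mp, OF that(3)])
        show "framework_claim k R t \<eta> (N * K ^ d) h \<beta>3 n" using IH nn(3) by blast
      qed (use a R Suc.prems K nn(1) \<eta> \<beta>1 s1 s2 s3 dd in \<open>auto simp: L_def h_def d_def\<close>)
    qed
  qed
qed

section \<open>Sorting by cells\<close>

lemma sort_by_key:
  fixes key :: "nat \<Rightarrow> int"
  assumes inj: "inj_on key {1..n}"
  shows "\<exists>p. p permutes {1..n} \<and> (\<forall>i\<in>{1..n}. p i = card {j\<in>{1..n}. key j \<le> key i}) \<and>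
     (\<forall>i\<in>{1..n}. \<forall>j\<in>{1..n}. p i < p j \<longleftrightarrow> key i < key j)"
proof -
  define p where "p i = (if i \<in> {1..n} then card {j\<in>{1..n}. key j \<le> key i} else i)" for i
  have less: "p i < p j" if "i \<in> {1..n}" "j \<in> {1..n}" "key i < key j" for i j
  proof -
    have "{x\<in>{1..n}. key x \<le> key i} \<subseteq> {x\<in>{1..n}. key x \<le> key j}" using that by auto
    moreover have "j \<in> {x\<in>{1..n}. key x \<le> key j} - {x\<in>{1..n}. key x \<le> key i}" using that by simp
    ultimately have "{x\<in>{1..n}. key x \<le> key i} \<subset> {x\<in>{1..n}. key x \<le> key j}" by blast
    then show ?thesis using that psubset_card_mono[of "{x\<in>{1..n}. key x \<le> key j}"] by (simp add: p_def)
  qed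
  have iff: "p i < p j \<longleftrightarrow> key i < key j" if "i \<in> {1..n}" "j \<in> {1..n}" for i j
    using less[OF that] less[OF that(2,1)] inj_onD[OF inj _ that] by (metis less_asym less_irrefl linorder_neqE)
  have img: "p ` {1..n} \<subseteq> {1..n}"
  proof (rule image_subsetI)
    fix i assume i: "i \<in> {1..n}"
    have "card {j\<in>{1..n}. key j \<le> key i} \<le> card {1..n}" by (intro card_mono) auto
    moreover have "card {j\<in>{1..n}. key j \<le> key i} > 0" using i by (subst card_gt_0_iff) auto
    ultimately show "p i \<in> {1..n}" using i by (simp add: p_def)
  qed
  have injp: "inj_on p {1..n}"
  proof (rule inj_onI)
    fix x y assume xy: "x \<in> {1..n}" "y \<in> {1..n}" "p x = p y"
    then have "key x = key y" using less[OF xy(1,2)] less[OF xy(2,1)] by (metis less_irrefl linorder_neqE)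
    then show "x = y" using inj xy by (meson inj_onD)
  qed
  have "p ` {1..n} = {1..n}" by (rule endo_inj_surj[OF _ img injp]) simp
  then have "bij_betw p {1..n} {1..n}" using injp by (simp add: bij_betw_def)
  then have "p permutes {1..n}" by (rule bij_imp_permutes) (simp only: p_def if_False)
  then show ?thesis using iff by (intro exI[of _ p] conjI ballI) (simp_all only: p_def if_True)
qed

lemma card_le_value:
  assumes "\<pi> permutes {1..n}" "i \<in> {1..n}"
  shows "\<pi> i = card {j\<in>{1..n}. \<pi> j \<le> \<pi> i}"
proof -
  have le: "\<pi> i \<le> n" using assms permutes_in_image by fastforce
  have "\<pi> ` {j\<in>{1..n}. \<pi> j \<le> \<pi> i} = {1..\<pi> i}"
  proof
    show "\<pi> ` {j\<in>{1..n}. \<pi> j \<le> \<pi> i} \<subseteq> {1..\<pi> i}" using assms(1) permutes_in_image by fastforce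
    show "{1..\<pi> i} \<subseteq> \<pi> ` {j\<in>{1..n}. \<pi> j \<le> \<pi> i}"
    proof
      fix v assume v: "v \<in> {1..\<pi> i}"
      then have "v \<in> \<pi> ` {1..n}" using permutes_image[OF assms(1)] le by simp
      then show "v \<in> \<pi> ` {j\<in>{1..n}. \<pi> j \<le> \<pi> i}" using v by auto
    qed
  qed
  moreover have "inj_on \<pi> {j\<in>{1..n}. \<pi> j \<le> \<pi> i}" using assms(1) permutes_inj by (metis inj_on_subset subset_UNIV)
  ultimately show ?thesis using card_image by (metis card_atLeastAtMost diff_Suc_1)
qed

text \<open>The pattern \<open>A\<close> is indexed from \<open>1\<close>, the sets \<open>V a\<close> from \<open>0\<close>; hence the successors.\<close>
lemma many_patterns:
  fixes V :: "nat \<Rightarrow> nat set" and w :: real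
  assumes p: "\<pi> permutes {1..n}" and kn: "k \<le> n" and w: "w \<ge> 0"
    and V: "\<And>a. a < k \<Longrightarrow> V a \<subseteq> {1..n} \<and> w * n \<le> real (card (V a))"
    and pos: "\<And>a b x y. a < b \<Longrightarrow> b < k \<Longrightarrow> x \<in> V a \<Longrightarrow> y \<in> V b \<Longrightarrow> x < y"
    and val: "\<And>a b x y. a < k \<Longrightarrow> b < k \<Longrightarrow> x \<in> V a \<Longrightarrow> y \<in> V b \<Longrightarrow> a \<noteq> b \<Longrightarrow> A (Suc a) < A (Suc b) \<longleftrightarrow> \<pi> x < \<pi> y"
  shows "w ^ k \<le> pattern_density k A n \<pi>"
proof -
  define T where "T = PiE {..<k} V"
  define occ where "occ = {K. K \<subseteq> {1..n} \<and> card K = k \<and> induces_pattern k A K \<pi>}"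
  have finV: "finite (V a)" if "a < k" for a using V[OF that] finite_subset by blast
  have mono: "t a < t b" if "t \<in> T" "a < b" "b < k" for t a b
    using that pos[OF that(2,3)] unfolding T_def by (metis PiE_mem lessThan_iff less_trans)
  have list: "sorted_list_of_set (t ` {..<k}) = map t [0..<k]" if "t \<in> T" for t
  proof -
    have "sorted_wrt (<) (map t [0..<k])"
      using mono[OF that] by (auto simp: sorted_wrt_iff_nth_less)
    then have "sorted_list_of_set (set (map t [0..<k])) = map t [0..<k]"
      by (metis sorted_list_of_set.idem_if_sorted_distinct strict_sorted_iff)
    then show ?thesis by (simp add: atLeast0LessThan)
  qed
  have ith: "ith_smallest (t ` {..<k}) (Suc a) = t a" if "t \<in> T" "a < k" for t a
    unfolding ith_smallest_def list[OF that(1)] using that(2) by simp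
  have injT: "inj_on (\<lambda>t. t ` {..<k}) T"
  proof (rule inj_onI)
    fix t t' assume t: "t \<in> T" "t' \<in> T" "t ` {..<k} = t' ` {..<k}"
    show "t = t'"
    proof (rule PiE_ext[of t "{..<k}" V])
      show "t \<in> PiE {..<k} V" "t' \<in> PiE {..<k} V" using t by (simp_all add: T_def)
      show "t x = t' x" if "x \<in> {..<k}" for x
        using ith[OF t(1), of x] ith[OF t(2), of x] t(3) that by simp
    qed
  qed
  have sub: "(\<lambda>t. t ` {..<k}) ` T \<subseteq> occ"
  proof (rule image_subsetI)
    fix t assume t: "t \<in> T"
    have tV: "t a \<in> V a" if "a < k" for a using t that by (auto simp: T_def)
    have inj: "inj_on t {..<k}"
      using mono[OF t] by (intro inj_onI) (metis lessThan_iff less_irrefl linorder_neqE_nat)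
    have "induces_pattern k A (t ` {..<k}) \<pi>"
      unfolding induces_pattern_def
    proof (intro ballI)
      fix i j assume ij: "i \<in> {1..k}" "j \<in> {1..k}"
      obtain a b where ab: "i = Suc a" "j = Suc b" "a < k" "b < k"
        using that[of "i - 1" "j - 1"] ij by auto
      show "A i < A j \<longleftrightarrow> \<pi> (ith_smallest (t ` {..<k}) i) < \<pi> (ith_smallest (t ` {..<k}) j)"
        unfolding ab(1,2) ith[OF t ab(3)] ith[OF t ab(4)]
      proof (cases "a = b")
        case False
        show "A (Suc a) < A (Suc b) \<longleftrightarrow> \<pi> (t a) < \<pi> (t b)"
          by (rule val[OF ab(3,4) tV[OF ab(3)] tV[OF ab(4)] False])
      qed (simp only: less_irrefl)
    qed
    moreover have "t ` {..<k} \<subseteq> {1..n}" using tV V by blast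
    moreover have "card (t ` {..<k}) = k" using card_image[OF inj] by simp
    ultimately show "t ` {..<k} \<in> occ" by (simp add: occ_def)
  qed
  have finocc: "finite occ" unfolding occ_def by (rule finite_subset[of _ "Pow {1..n}"]) auto
  have "(w * n) ^ k = (\<Prod>a<k. w * n)" by simp
  also have "\<dots> \<le> (\<Prod>a<k. real (card (V a)))" using V w by (intro prod_mono) auto
  also have "\<dots> = real (card T)" unfolding T_def by (simp add: card_PiE)
  also have "card T \<le> card occ" using card_image[OF injT] card_mono[OF finocc sub] by simp
  finally have le: "(w * n) ^ k \<le> real (card occ)" by simp
  have ch: "0 < n choose k" using kn by simp
  have "w ^ k * real (n choose k) \<le> w ^ k * real n ^ k"
    using w binomial_le_pow[OF kn] by (intro mult_left_mono) (simp_all flip: of_nat_power)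
  also have "\<dots> \<le> real (card occ)" using le by (simp add: power_mult_distrib)
  finally show ?thesis unfolding pattern_density_def occ_def[symmetric] using ch by (simp add: pos_le_divide_eq)
qed

text \<open>
  With this retraction onto \<open>X\<close>, every position outside \<open>X\<close> is assigned to the cell of a point of \<open>X\<close>, and the
  column is still a nondecreasing function of the position.
\<close>
lemma nearest_point:
  fixes X :: "nat set"
  assumes "finite X" "X \<noteq> {}"
  shows "\<exists>g. mono g \<and> (\<forall>i. g i \<in> X) \<and> (\<forall>i\<in>X. g i = i)"
proof -
  define g where "g i = (if \<exists>j\<in>X. j \<le> i then Max {j\<in>X. j \<le> i} else Min X)" for i
  have mem: "g i \<in> {j\<in>X. j \<le> i}" if "\<exists>j\<in>X. j \<le> i" for i
  proof -
    have "Max {j\<in>X. j \<le> i} \<in> {j\<in>X. j \<le> i}" using that assms(1) by (intro Max_in) auto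
    then show ?thesis using that by (simp only: g_def if_True)
  qed
  have gX: "g i \<in> X" for i using mem[of i] assms by (cases "\<exists>j\<in>X. j \<le> i") (auto simp: g_def)
  moreover have "mono g"
  proof (rule monoI)
    fix i j :: nat assume ij: "i \<le> j"
    show "g i \<le> g j"
    proof (cases "\<exists>x\<in>X. x \<le> i")
      case True
      then have "{x\<in>X. x \<le> i} \<noteq> {}" "\<exists>x\<in>X. x \<le> j" using ij by (blast, meson le_trans)
      then show ?thesis using True ij assms(1) unfolding g_def by (auto intro!: Max_mono)
    next
      case False
      then have "g i = Min X" by (auto simp: g_def)
      then show ?thesis using gX[of j] assms(1) by simp
    qed
  qed
  moreover have "g i = i" if "i \<in> X" for i
  proof -
    have ex: "\<exists>j\<in>X. j \<le> i" using that by blast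
    have "Max {j\<in>X. j \<le> i} = i" using that assms(1) by (intro Max_eqI) auto
    then show ?thesis using ex by (simp add: g_def)
  qed
  ultimately show ?thesis by blast
qed

text \<open>
  The permutation \<open>\<pi>'\<close> sorts the positions \<open>i\<close> by \<open>m i\<close>, a value that represents the cell of \<open>i\<close>,
  and within one cell increasingly or decreasingly according to the direction of its boxes.
\<close>
lemma framework_modification:
  fixes \<theta> \<beta> :: real
  assumes p: "\<pi> permutes {1..n}" and R: "R \<ge> 1" and k: "k \<ge> 1" "k \<le> n"
    and fw: "framework n \<pi> k R (\<beta> * n) S X B" and b: "\<beta> > 0"
    and X: "X \<subseteq> {1..n}" "X \<noteq> {}" "real (card ({1..n} - X)) \<le> \<theta> * n"
  shows "\<exists>\<pi>'. \<pi>' permutes {1..n} \<and>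
     (\<Sum>i=1..n. \<bar>real (\<pi> i) - real (\<pi>' i)\<bar>) \<le> (2 * \<theta> + 1 / R + 1 / n) * (real n)\<^sup>2 \<and>
     (pattern_avoiding k A n \<pi>' \<or> \<beta> ^ k \<le> pattern_density k A n \<pi>)"
proof -
  have n: "n \<ge> 1" using k by simp
  have inj\<pi>: "\<pi> x = \<pi> y \<Longrightarrow> x = y" for x y using p permutes_inj by (metis injD)
  have fam: "ordered_family S" and XS: "X \<subseteq> \<Union>S" 
    and box: "\<forall>c\<in>S. boxes \<pi> k (\<beta> * n) (row n \<pi> R ` (X \<inter> c)) (B c)"
    and Bsub: "\<forall>c\<in>S. \<forall>r\<in>row n \<pi> R ` (X \<inter> c). \<forall>a<k. B c r a \<subseteq> c \<inter> {i\<in>{1..n}. row n \<pi> R i = r}"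
    and sep: "\<forall>c\<in>S. \<forall>c'\<in>S. c \<noteq> c' \<longrightarrow> (\<forall>r\<in>row n \<pi> R ` (X \<inter> c) \<inter> row n \<pi> R ` (X \<inter> c').
        before \<pi> (\<Union>a<k. B c r a) (\<Union>a<k. B c' r a) \<or> before \<pi> (\<Union>a<k. B c' r a) (\<Union>a<k. B c r a))"
    using fw unfolding framework_def by blast+
  have finX: "finite X" using X finite_subset by blast
  obtain g where g: "mono g" "\<And>i. g i \<in> X" "\<And>i. i \<in> X \<Longrightarrow> g i = i" using nearest_point[OF finX X(2)] by blast
  have "\<forall>i. \<exists>c. c \<in> S \<and> g i \<in> c" using g(2) XS by blast
  then obtain col where col: "\<And>i. col i \<in> S" "\<And>i. g i \<in> col i" by metis
  define r where "r i = row n \<pi> R (g i)" for i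
  have r: "r i \<in> row n \<pi> R ` (X \<inter> col i)" for i unfolding r_def using g(2) col(2) by blast
  define V where "V i a = B (col i) (r i) a" for i a
  have Vsub: "V i a \<subseteq> col i" "V i a \<subseteq> {1..n}" "\<And>x. x \<in> V i a \<Longrightarrow> row n \<pi> R x = r i" if "a < k" for i a
    using Bsub col(1) r that unfolding V_def by blast+
  have Vbox: "boxes \<pi> k (\<beta> * n) (row n \<pi> R ` (X \<inter> col i)) (B (col i))" for i using box col(1) by blast
  have Vcard: "\<beta> * n \<le> real (card (V i a))" if "a < k" for i a
    using Vbox[of i] r[of i] that unfolding boxes_def V_def by blast
  have Vne: "\<exists>x. x \<in> V i 0" for i
  proof -
    have "0 < \<beta> * n" using b n by simp
    then have "0 < real (card (V i 0))" using Vcard[of 0 i] k by linarith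
    then show ?thesis by (metis card.empty ex_in_conv less_irrefl of_nat_0)
  qed
  \<comment> \<open>The least value in the box with index \<open>0\<close> identifies the cell, and it is ordered as the
    boxes of the cells are; hence it is compatible with the order of the rows.\<close>
  define m where "m i = Min (\<pi> ` V i 0)" for i
  have mV: "\<exists>x\<in>V i 0. m i = \<pi> x" for i
  proof -
    have "finite (V i 0)" using Vsub(2)[of 0 i] k finite_subset by auto
    then have "m i \<in> \<pi> ` V i 0" unfolding m_def using Vne[of i] by (intro Min_in) auto
    then show ?thesis by blast
  qed
  have k0: "0 < k" using k by simp
  have cell: "col i = col j \<and> r i = r j" if "m i = m j" for i j
  proof -
    obtain x y where x: "x \<in> V i 0" "m i = \<pi> x" and y: "y \<in> V j 0" "m j = \<pi> y" using mV by meson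
    have xy: "x = y" using x y that inj\<pi> by simp
    have rr: "r i = r j" using Vsub(3)[OF k0 x(1)] Vsub(3)[OF k0 y(1)] xy by simp
    have "x \<in> col i" "x \<in> col j" using Vsub(1)[OF k0] x y xy by blast+
    then have "col i = col j" using ordered_family_disjoint[OF fam col(1) col(1)] by blast
    then show ?thesis using rr by simp
  qed
  have across: "\<pi> x < \<pi> y" if m: "m i < m j" and "a < k" "b < k" and x: "x \<in> V i a" and y: "y \<in> V j b" for i j a b x y
  proof -
    obtain x0 y0 where x0: "x0 \<in> V i 0" "m i = \<pi> x0" and y0: "y0 \<in> V j 0" "m j = \<pi> y0" using mV by meson
    show ?thesis
    proof (cases "r i = r j")
      case False
      have "r i \<le> r j" using row_mono[of \<pi> x0 y0 n R] m x0 y0 Vsub(3)[OF k0 x0(1)] Vsub(3)[OF k0 y0(1)] by simp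
      then have "row n \<pi> R x < row n \<pi> R y" using False Vsub(3)[OF \<open>a < k\<close> x] Vsub(3)[OF \<open>b < k\<close> y] by simp
      then show ?thesis by (rule row_less_imp)
    next
      case True
      have "col i \<noteq> col j"
      proof
        assume "col i = col j"
        then have "m i = m j" using True by (simp add: m_def V_def)
        then show False using m by simp
      qed
      moreover have "r i \<in> row n \<pi> R ` (X \<inter> col i) \<inter> row n \<pi> R ` (X \<inter> col j)" using r[of i] r[of j] True by simp
      ultimately have "before \<pi> (\<Union>a<k. V i a) (\<Union>a<k. V j a) \<or> before \<pi> (\<Union>a<k. V j a) (\<Union>a<k. V i a)"
        using sep col(1) True unfolding V_def by metis
      moreover have "\<not> before \<pi> (\<Union>a<k. V j a) (\<Union>a<k. V i a)"
      proof
        assume "before \<pi> (\<Union>a<k. V j a) (\<Union>a<k. V i a)"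
        then have "\<pi> y0 < \<pi> x0" using x0(1) y0(1) k0 unfolding before_def by blast
        then show False using m x0 y0 by simp
      qed
      ultimately show ?thesis using x y that unfolding before_def by blast
    qed
  qed
  define inc where "inc i \<longleftrightarrow> (\<forall>a b. a < b \<and> b < k \<longrightarrow> before \<pi> (V i a) (V i b))" for i
  have dec: "before \<pi> (V i b) (V i a)" if "\<not> inc i" "a < b" "b < k" for i a b
    using Vbox[of i] r[of i] that unfolding boxes_def V_def inc_def by blast
  \<comment> \<open>The factor \<open>2 n + 1\<close> exceeds any difference of the second summands.\<close>
  define key where "key i = int (m i) * (2 * int n + 1) + (if inc i then int i else - int i)" for i
  have key_less: "key i < key j" if "m i < m j" "i \<in> {1..n}" "j \<in> {1..n}" for i j
  proof -
    have "(int (m i) + 1) * (2 * int n + 1) \<le> int (m j) * (2 * int n + 1)" using that by (intro mult_right_mono) auto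
    then have "int (m i) * (2 * int n + 1) + (2 * int n + 1) \<le> int (m j) * (2 * int n + 1)" by (simp add: distrib_right)
    then show ?thesis using that(2,3) unfolding key_def by auto
  qed
  have inc_same: "inc i = inc j" if "m i = m j" for i j using cell[OF that] by (simp add: inc_def V_def)
  have "inj_on key {1..n}"
  proof (rule inj_onI)
    fix i j assume ij: "i \<in> {1..n}" "j \<in> {1..n}" "key i = key j"
    have "m i = m j" using key_less[OF _ ij(1,2)] key_less[OF _ ij(2,1)] ij(3) by (metis less_irrefl linorder_neqE_nat)
    then show "i = j" using ij(3) inc_same[of i j] by (simp add: key_def split: if_splits)
  qed
  from sort_by_key[OF this] obtain \<pi>' where \<pi>': "\<pi>' permutes {1..n}"
    "\<And>i. i \<in> {1..n} \<Longrightarrow> \<pi>' i = card {j\<in>{1..n}. key j \<le> key i}"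
    "\<And>i j. i \<in> {1..n} \<Longrightarrow> j \<in> {1..n} \<Longrightarrow> \<pi>' i < \<pi>' j \<longleftrightarrow> key i < key j" by blast
  \<comment> \<open>For a kept position \<open>i\<close>, the sets counted by \<open>\<pi> i\<close> and by \<open>\<pi>' i\<close> differ only in positions that are
    not kept or in the row of \<open>i\<close>.\<close>
  have moved: "\<bar>real (\<pi> i) - real (\<pi>' i)\<bar> \<le> \<theta> * n + n / R + 1" if i: "i \<in> X" for i
  proof -
    have i1: "i \<in> {1..n}" using X(1) i by blast
    define E where "E = ({1..n} - X) \<union> {j\<in>{1..n}. row n \<pi> R j = row n \<pi> R i}"
    have finE: "finite E" by (simp add: E_def)
    define P where "P = {j\<in>{1..n}. key j \<le> key i}"
    define P2 where "P2 = {j\<in>{1..n}. \<pi> j \<le> \<pi> i}"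
    have same: "j \<in> P \<longleftrightarrow> j \<in> P2" if "j \<in> {1..n}" "j \<notin> E" for j
    proof -
      have jX: "j \<in> X" and ne: "row n \<pi> R j \<noteq> row n \<pi> R i" using that by (auto simp: E_def)
      have rj: "r j = row n \<pi> R j" "r i = row n \<pi> R i" using g(3) jX i by (simp_all add: r_def)
      obtain x y where x: "x \<in> V i 0" "m i = \<pi> x" and y: "y \<in> V j 0" "m j = \<pi> y" using mV by meson
      have rx: "row n \<pi> R x = r i" "row n \<pi> R y = r j" using Vsub(3)[OF k0] x y by blast+
      show ?thesis
      proof (cases "r j < r i")
        case True
        then have "\<pi> y < \<pi> x" using row_less_imp[of n \<pi> R y x] rx by simp
        then have "key j < key i" using key_less that(1) i1 x y by simp
        moreover have "\<pi> j < \<pi> i" using True rj row_less_imp[of n \<pi> R j i] by simp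
        ultimately show ?thesis using that(1) by (simp add: P_def P2_def)
      next
        case False
        then have lt: "r i < r j" using ne rj by simp
        then have "\<pi> x < \<pi> y" using row_less_imp[of n \<pi> R x y] rx by simp
        then have "key i < key j" using key_less that(1) i1 x y by simp
        moreover have "\<pi> i < \<pi> j" using lt rj row_less_imp[of n \<pi> R i j] by simp
        ultimately show ?thesis by (simp add: P_def P2_def)
      qed
    qed
    have fin: "finite P" "finite P2" by (simp_all add: P_def P2_def)
    have "P \<subseteq> P2 \<union> E" "P2 \<subseteq> P \<union> E" using same unfolding P_def P2_def by blast+
    then have "card P \<le> card P2 + card E" "card P2 \<le> card P + card E"
      using fin finE card_mono[of "P2 \<union> E" P] card_mono[of "P \<union> E" P2] card_Un_le[of P2 E] card_Un_le[of P E] by auto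
    then have "\<bar>real (card P2) - real (card P)\<bar> \<le> real (card E)" by linarith
    moreover have "\<pi> i = card P2" unfolding P2_def by (rule card_le_value[OF p i1])
    moreover have "\<pi>' i = card P" unfolding P_def by (rule \<pi>'(2)[OF i1])
    moreover have "real (card E) \<le> \<theta> * n + (n / R + 1)"
    proof -
      have "card E \<le> card ({1..n} - X) + card {j\<in>{1..n}. row n \<pi> R j = row n \<pi> R i}" unfolding E_def by (rule card_Un_le)
      then have "real (card E) \<le> real (card ({1..n} - X)) + real (card {j\<in>{1..n}. row n \<pi> R j = row n \<pi> R i})" by linarith
      moreover have "real (card {j\<in>{1..n}. row n \<pi> R j = row n \<pi> R i}) \<le> n / R + 1"
        using R by (intro card_row_le[OF p]) simp
      ultimately show ?thesis using X(3) by linarith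
    qed
    ultimately show ?thesis by simp
  qed
  have any: "\<bar>real (\<pi> i) - real (\<pi>' i)\<bar> \<le> n" if "i \<in> {1..n}" for i
  proof -
    have "\<pi> i \<in> {1..n}" "\<pi>' i \<in> {1..n}" using p \<pi>'(1) that permutes_in_image by metis+
    then have "real (\<pi> i) \<le> n" "real (\<pi>' i) \<le> n" by simp_all
    then show ?thesis by linarith
  qed
  have \<theta>: "\<theta> \<ge> 0"
  proof -
    have "0 \<le> \<theta> * n" using X(3) by (rule order.trans[rotated]) simp
    then show ?thesis using n by (auto simp: zero_le_mult_iff)
  qed
  have "(\<Sum>i=1..n. \<bar>real (\<pi> i) - real (\<pi>' i)\<bar>) = (\<Sum>i\<in>X. \<bar>real (\<pi> i) - real (\<pi>' i)\<bar>) + (\<Sum>i\<in>{1..n} - X. \<bar>real (\<pi> i) - real (\<pi>' i)\<bar>)"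
    using sum.subset_diff[OF X(1), of "\<lambda>i. \<bar>real (\<pi> i) - real (\<pi>' i)\<bar>"] by simp
  also have "\<dots> \<le> (\<Sum>i\<in>X. \<theta> * n + n / R + 1) + (\<Sum>i\<in>{1..n} - X. real n)"
    using moved any by (intro add_mono sum_mono) auto
  also have "\<dots> = real (card X) * (\<theta> * n + n / R + 1) + real (card ({1..n} - X)) * n" by simp
  also have "\<dots> \<le> real n * (\<theta> * n + n / R + 1) + \<theta> * n * n"
  proof (intro add_mono mult_right_mono)
    show "real (card X) \<le> real n" using card_mono[OF _ X(1)] by simp
    show "0 \<le> \<theta> * n + n / R + 1" using \<theta> by simp
  qed (use X(3) in simp_all)
  also have "\<dots> = (2 * \<theta> + 1 / R + 1 / n) * (real n)\<^sup>2"
    using n R by (simp add: field_simps power2_eq_square)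
  finally have dist: "(\<Sum>i=1..n. \<bar>real (\<pi> i) - real (\<pi>' i)\<bar>) \<le> (2 * \<theta> + 1 / R + 1 / n) * (real n)\<^sup>2" .
  \<comment> \<open>In a copy of \<open>A\<close> in \<open>\<pi>'\<close>, the \<open>a\<close>-th point may be replaced by any point of box \<open>a\<close> of its cell.\<close>
  have copies: "\<beta> ^ k \<le> pattern_density k A n \<pi>" if "\<not> pattern_avoiding k A n \<pi>'"
  proof -
    have "card {K. K \<subseteq> {1..n} \<and> card K = k \<and> induces_pattern k A K \<pi>'} \<noteq> 0"
      using that unfolding pattern_avoiding_def pattern_density_def by (metis div_0 of_nat_0)
    then obtain Z where Z: "Z \<subseteq> {1..n}" "card Z = k" "induces_pattern k A Z \<pi>'"
      by (metis (mono_tags, lifting) Collect_empty_eq card.empty)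
    have finZ: "finite Z" using Z finite_subset by blast
    define e where "e a = sorted_list_of_set Z ! a" for a
    have len: "length (sorted_list_of_set Z) = k" using Z by simp
    have eZ: "e a \<in> {1..n}" if "a < k" for a using that len finZ Z(1) by (metis nth_mem set_sorted_list_of_set e_def subsetD)
    have elt: "e a < e b" if "a < b" "b < k" for a b
      using that len strict_sorted_list_of_set[of Z] by (auto simp: e_def sorted_wrt_iff_nth_less)
    have pat: "A (Suc a) < A (Suc b) \<longleftrightarrow> key (e a) < key (e b)" if "a < k" "b < k" for a b
    proof -
      have "A (Suc a) < A (Suc b) \<longleftrightarrow> \<pi>' (ith_smallest Z (Suc a)) < \<pi>' (ith_smallest Z (Suc b))"
        using Z(3) that unfolding induces_pattern_def by (metis Suc_leI atLeastAtMost_iff le_add1 plus_1_eq_Suc)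
      then show ?thesis using \<pi>'(3)[OF eZ[OF that(1)] eZ[OF that(2)]] by (simp add: ith_smallest_def e_def)
    qed
    have pos: "x < y" if ab: "a < b" "b < k" and x: "x \<in> V (e a) a" and y: "y \<in> V (e b) b" for a b x y
    proof (cases "col (e a) = col (e b)")
      case True
      have "before id (V (e a) a) (V (e b) b)"
        using Vbox[of "e a"] r[of "e a"] r[of "e b"] ab True unfolding boxes_def V_def by metis
      then show ?thesis using x y by (simp add: before_def)
    next
      case False
      have "g (e a) \<le> g (e b)" using g(1) elt[OF ab] by (simp add: monoD)
      then have "\<not> before id (col (e b)) (col (e a))" using col(2) unfolding before_def by (metis id_apply not_less)
      then have "before id (col (e a)) (col (e b))" using ordered_familyD[OF fam col(1) col(1) False] by blast
      then show ?thesis using x y Vsub(1) ab unfolding before_def by (metis id_apply less_trans subsetD)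
    qed
    have val: "key (e a) < key (e b) \<longleftrightarrow> \<pi> x < \<pi> y" if ab: "a < b" "b < k" and x: "x \<in> V (e a) a" and y: "y \<in> V (e b) b" for a b x y
    proof -
      have a: "a < k" using ab by simp
      consider "m (e a) < m (e b)" | "m (e b) < m (e a)" | "m (e a) = m (e b)" by linarith
      then show ?thesis
      proof cases
        case 1
        then show ?thesis using key_less[OF 1 eZ[OF a] eZ[OF ab(2)]] across[OF 1 a ab(2) x y] by simp
      next
        case 2
        then show ?thesis using key_less[OF 2 eZ[OF ab(2)] eZ[OF a]] across[OF 2 ab(2) a y x] by simp
      next
        case 3
        have same: "V (e b) = V (e a)" using cell[OF 3] unfolding V_def by (intro ext) simp
        show ?thesis
        proof (cases "inc (e a)")
          case True
          then have "\<pi> x < \<pi> y" using x y ab unfolding inc_def same before_def by blast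
          then show ?thesis using True inc_same[OF 3] 3 elt[OF ab] by (simp add: key_def)
        next
          case False
          then have "\<pi> y < \<pi> x" using dec[OF False ab] x y unfolding same before_def by blast
          then show ?thesis using False inc_same[OF 3] 3 elt[OF ab] by (simp add: key_def)
        qed
      qed
    qed
    show ?thesis
    proof (rule many_patterns[OF p k(2), where V = "\<lambda>a. V (e a) a"])
      show "0 \<le> \<beta>" using b by simp
      show "V (e a) a \<subseteq> {1..n} \<and> \<beta> * n \<le> real (card (V (e a) a))" if "a < k" for a
        using Vsub(2) Vcard that by blast
      show "x < y" if "a < b" "b < k" "x \<in> V (e a) a" "y \<in> V (e b) b" for a b x y by (rule pos[OF that])
      show "A (Suc a) < A (Suc b) \<longleftrightarrow> \<pi> x < \<pi> y" 
        if "a < k" "b < k" and xy: "x \<in> V (e a) a" "y \<in> V (e b) b" and "a \<noteq> b" for a b x y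
      proof (cases "a < b")
        case True
        then show ?thesis using val[OF True that(2) xy] pat[OF that(1,2)] by simp
      next
        case False
        then have ba: "b < a" using that by simp
        have "\<pi> x \<noteq> \<pi> y" using inj\<pi> pos[OF ba that(1) xy(2,1)] by blast
        moreover have "key (e a) \<noteq> key (e b)"
          using inj_onD[OF \<open>inj_on key {1..n}\<close> _ eZ[OF that(1)] eZ[OF that(2)]] elt[OF ba that(1)] by force
        ultimately show ?thesis using val[OF ba that(1) xy(2,1)] pat[OF that(1,2)] by linarith
      qed
    qed
  qed
  show ?thesis using \<pi>'(1) dist copies by blast
qed

section \<open>The removal lemma\<close>

theorem theorem1p2:
  fixes k :: nat and A :: "nat \<Rightarrow> nat"
  assumes "k \<ge> 1" and "A permutes {1..k}"
  shows "\<forall>\<epsilon>::real. \<epsilon> > 0 \<longrightarrow> (\<exists>\<delta>::real. \<delta> > 0 \<and>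
    (\<forall>n::nat. n \<ge> k \<longrightarrow>
      (\<forall>\<pi>. \<pi> permutes {1..n} \<and> pattern_density k A n \<pi> < \<delta> \<longrightarrow>
        (\<exists>\<pi>'. \<pi>' permutes {1..n} \<and> pattern_avoiding k A n \<pi>' \<and>
          (\<Sum>i=1..n. \<bar>real (\<pi> i) - real (\<pi>' i)\<bar>) < \<epsilon> * (real n)\<^sup>2))))"
proof (intro allI impI)
  fix \<epsilon> :: real assume \<epsilon>: "\<epsilon> > 0"
  define \<theta> where "\<theta> = min (\<epsilon> / 8) (1 / 2)"
  have \<theta>: "\<theta> > 0" "\<theta> \<le> \<epsilon> / 8" "\<theta> \<le> 1 / 2" using \<epsilon> by (auto simp: \<theta>_def)
  obtain R0 :: nat where R0: "8 / \<epsilon> \<le> R0" using real_arch_simple by blast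
  define R where "R = Suc R0"
  have R: "R \<ge> 1" "1 / real R \<le> \<epsilon> / 8"
  proof -
    have "8 / \<epsilon> \<le> R" using R0 by (simp add: R_def)
    then show "1 / real R \<le> \<epsilon> / 8" using \<epsilon> by (simp add: field_simps R_def)
  qed (simp add: R_def)
  from framework_exists[OF R(1) \<theta>(1), of 1 k R 1] obtain \<beta> n0
    where \<beta>: "\<beta> > 0" "\<And>n. n \<ge> n0 \<Longrightarrow> framework_claim k R R \<theta> 1 1 \<beta> n" by auto
  define M where "M = max n0 R"
  define \<delta> where "\<delta> = min (\<beta> ^ k) (1 / 2 ^ M)"
  show "\<exists>\<delta>::real. \<delta> > 0 \<and>
    (\<forall>n::nat. n \<ge> k \<longrightarrow>
      (\<forall>\<pi>. \<pi> permutes {1..n} \<and> pattern_density k A n \<pi> < \<delta> \<longrightarrow>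
        (\<exists>\<pi>'. \<pi>' permutes {1..n} \<and> pattern_avoiding k A n \<pi>' \<and>
          (\<Sum>i=1..n. \<bar>real (\<pi> i) - real (\<pi>' i)\<bar>) < \<epsilon> * (real n)\<^sup>2)))"
  proof (intro exI[of _ \<delta>] conjI allI impI)
    show "\<delta> > 0" using \<beta> by (simp add: \<delta>_def)
    fix n \<pi> assume nk: "n \<ge> k" and "\<pi> permutes {1..n} \<and> pattern_density k A n \<pi> < \<delta>"
    then have p: "\<pi> permutes {1..n}" and dens: "pattern_density k A n \<pi> < \<delta>" by auto
    have n1: "n \<ge> 1" using nk assms(1) by simp
    have \<epsilon>n: "0 < \<epsilon> * (real n)\<^sup>2" using \<epsilon> n1 by simp
    show "\<exists>\<pi>'. \<pi>' permutes {1..n} \<and> pattern_avoiding k A n \<pi>' \<and>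
          (\<Sum>i=1..n. \<bar>real (\<pi> i) - real (\<pi>' i)\<bar>) < \<epsilon> * (real n)\<^sup>2"
    proof (cases "n < M")
      case True
      \<comment> \<open>A single copy already has density at least \<open>1 / 2 ^ n\<close>.\<close>
      have "pattern_density k A n \<pi> = 0"
      proof (rule ccontr)
        assume ne: "pattern_density k A n \<pi> \<noteq> 0"
        define c where "c = card {K. K \<subseteq> {1..n} \<and> card K = k \<and> induces_pattern k A K \<pi>}"
        have "c \<noteq> 0" using ne unfolding pattern_density_def c_def by (metis div_0 of_nat_0)
        have ch: "0 < n choose k" using nk by simp
        have "n choose k \<le> 2 ^ n" by (rule binomial_le_pow2)
        also have "\<dots> \<le> 2 ^ M" using True by (intro power_increasing) auto
        finally have "real (n choose k) \<le> 2 ^ M" by (metis of_nat_le_iff of_nat_numeral of_nat_power)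
        then have "1 / 2 ^ M \<le> 1 / real (n choose k)" using ch by (intro divide_left_mono) auto
        also have "\<dots> \<le> real c / real (n choose k)" using \<open>c \<noteq> 0\<close> by (intro divide_right_mono) auto
        also have "\<dots> = pattern_density k A n \<pi>" by (simp add: pattern_density_def c_def)
        finally show False using dens by (simp add: \<delta>_def)
      qed
      then show ?thesis using p \<epsilon>n by (intro exI[of _ \<pi>]) (simp add: pattern_avoiding_def)
    next
      case False
      then have n: "n \<ge> n0" "n \<ge> R" by (auto simp: M_def)
      have "ordered_family {{1..n}}" by (simp add: ordered_family_def)
      moreover have "card (row n \<pi> R ` {1..n}) \<le> R"
      proof -
        have "row n \<pi> R ` {1..n} \<subseteq> {..<R}" using row_lt[OF p] R(1) by auto
        then have "card (row n \<pi> R ` {1..n}) \<le> card {..<R}" by (intro card_mono) auto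
        then show ?thesis by simp
      qed
      moreover have "\<exists>q m. {1..n} = {q..<q + m}" by (intro exI[of _ 1] exI[of _ n]) auto
      ultimately obtain S X B where fw: "framework n \<pi> k R (\<beta> * n) S X B" and X: "X \<subseteq> {1..n}"
        "real (card ({1..n} - X)) \<le> \<theta> * n"
        using \<beta>(2)[OF n(1), unfolded framework_claim_def, rule_format, of \<pi> "{{1..n}}" "{1..n}"] p by auto
      have Xne: "X \<noteq> {}"
      proof
        assume "X = {}"
        then have "real n \<le> \<theta> * n" using X(2) by simp
        also have "\<dots> \<le> 1 / 2 * n" using \<theta>(3) by (intro mult_right_mono) auto
        finally show False using n1 by simp
      qed
      from framework_modification[OF p R(1) assms(1) nk fw \<beta>(1) X(1) Xne X(2), of A]
      obtain \<pi>' where \<pi>': "\<pi>' permutes {1..n}"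
        "(\<Sum>i=1..n. \<bar>real (\<pi> i) - real (\<pi>' i)\<bar>) \<le> (2 * \<theta> + 1 / R + 1 / n) * (real n)\<^sup>2"
        "pattern_avoiding k A n \<pi>' \<or> \<beta> ^ k \<le> pattern_density k A n \<pi>" by blast
      have "1 / real n \<le> 1 / real R" using n(2) R(1) by (intro divide_left_mono) auto
      then have "2 * \<theta> + 1 / R + 1 / n < \<epsilon>" using R(2) \<theta>(2) \<epsilon> by linarith
      then have "(2 * \<theta> + 1 / R + 1 / n) * (real n)\<^sup>2 < \<epsilon> * (real n)\<^sup>2" using n1 by (intro mult_strict_right_mono) auto
      moreover have "pattern_avoiding k A n \<pi>'" using \<pi>'(3) dens by (auto simp: \<delta>_def)
      ultimately show ?thesis using \<pi>'(1,2) by (intro exI[of _ \<pi>']) auto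
    qed
  qed
qed

end
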